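(* For every $\lambda>0$, the Laplace transform of $\psi_\lambda$ is equal to $$\mathcal{L}\psi_\lambda(z)=\int_0^\infty\psi_\lambda(x)e^{-zx}\,dx=\frac{\sqrt2}{2}\,\frac{\lambda\,e^{B(z/\lambda)}}{\lambda^2+z^2},\qquad \operatorname{Re}z>0.$$
   Context: For $\lambda>0$ and $x>0$, $$\psi_\lambda(x)=\sin\left(\lambda x+\tfrac{\pi}{8}\right)-r(\lambda x),\qquad r(x)=\frac{\sqrt2}{2\pi}\int_0^\infty\frac{t}{1+t^2}\exp\left(-\frac1\pi\int_0^\infty\frac{\log(t+s)}{1+s^2}\,ds\right)e^{-tx}\,dt.$$ The function $B$, holomorphic on $\mathbb{C}\setminus(-\infty,0]$, is $$B(z)=\frac1\pi\int_{-\infty}^0\frac{\log(z-s)}{1+s^2}\,ds,$$ with $\log$ the principal branch of the logarithm. *)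

theory Defs
  imports "HOL-Analysis.Analysis"
begin

definition log_potential :: "real \<Rightarrow> real" where
  "log_potential t = (1 / pi) * (LBINT s:{0<..}. ln (t + s) / (1 + s\<^sup>2))"

definition r :: "real \<Rightarrow> real" where
  "r x = sqrt 2 / (2 * pi) *
     (LBINT t:{0<..}. t / (1 + t\<^sup>2) * exp (- log_potential t) * exp (- (t * x)))"

definition psi :: "real \<Rightarrow> real \<Rightarrow> real" where
  "psi lam x = sin (lam * x + pi / 8) - r (lam * x)"

text \<open>
  Meaningful for \<^term>\<open>z\<close> off the closed negative half-line only; on positive reals it is
  \<^const>\<open>log_potential\<close>.
\<close>

definition B :: "complex \<Rightarrow> complex" where
  "B z = complex_of_real (1 / pi) *
     (LBINT s:{..0}. Ln (z - complex_of_real s) / complex_of_real (1 + s\<^sup>2))"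

definition laplace_integrand :: "(real \<Rightarrow> real) \<Rightarrow> complex \<Rightarrow> real \<Rightarrow> complex" where
  "laplace_integrand f z x = complex_of_real (f x) * exp (- z * complex_of_real x)"

definition laplace :: "(real \<Rightarrow> real) \<Rightarrow> complex \<Rightarrow> complex" where
  "laplace f z = (LBINT x:{0<..}. laplace_integrand f z x)"

end

theory Submission
  imports Defs "HOL-Complex_Analysis.Complex_Analysis" "HOL-Real_Asymp.Real_Asymp"
begin

text \<open>
  Write b for log_potential and B for its continuation to the slit plane. Laplace transforms
  are elementary for the sine, and Fubini's theorem turns the transform of r into a Stieltjes
  integral. With w = z / \<lambda> the claim then reduces to the identity

    e^B(w) / (1 + w^2) = \<surd>2 (cos(\<pi>/8) + w sin(\<pi>/8)) / (1 + w^2)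
       - (1/\<pi>) \<integral> t e^(-b(t)) / ((1 + t^2) (t + w)) dt,    Re w > 0,

  over t > 0 (lemma exp_B_stieltjes_representation). This is Cauchy's formula for the
  function on the left: the rational term collects the residues at \<plusminus>i, and the integral is
  the contribution of the cut along the negative half-line.

  The boundary values on the cut would be delicate to take directly, because the integral
  that defines B is logarithmically singular there. The reflection formula

    e^(B(w) + B(-w)) = 1 - i w,    Im w > 0    (exp_B_reflection)

  avoids this. It says that e^B(w) / (1 + w^2) equals e^(-B(-w)) / (1 + i w) in the
  upper half-plane, and by symmetry e^(-B(-w)) / (1 - i w) in the lower one. Both expressions
  are holomorphic across the negative half-line, so the two continuations can simply be evaluated at
  w = -t, and their difference is the density e^(-b(t)) t / (1 + t^2) up to a constant factor.
  The formula itself follows by differentiation: partial fractions give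
  B'(w) = (w/2 - Log w / \<pi>) / (1 + w^2), the logarithmic derivatives of both sides agree, and the
  constant is found by letting w tend to infinity along the imaginary axis.

  Substituting w = e^u opens the slit plane to the strip |Im u| < \<pi>. The keyhole contour becomes
  a rectangle, whose horizontal sides are the two banks of the cut and whose vertical sides
  vanish in the limit, since |e^B(w)| is at most a multiple of (1 + |w|)^(1/2) and |e^(-B(w))| at most
  |w|^(-1/2) for Re w \<ge> 0. The residues at \<plusminus>i need e^B(i) = \<surd>2 e^(i\<pi>/8):
  the modulus comes from the reflection formula at i, the phase from an arctangent integral.
\<close>

section \<open>Integrals over the positive half-line\<close>

lemma set_integrable_half_line_mono:
  fixes f :: "real \<Rightarrow> 'a :: {banach, second_countable_topology}" and g :: "real \<Rightarrow> real"
  assumes "set_integrable lborel {0<..} g" "continuous_on {0<..} f"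
    and "\<And>s. s > 0 \<Longrightarrow> norm (f s) \<le> g s"
  shows "set_integrable lborel {0<..} f"
proof (rule set_integrable_bound[OF assms(1)])
  show "set_borel_measurable lborel {0<..} f"
    using set_measurable_continuous_on[OF _ assms(2)] by (simp add: set_borel_measurable_def)
  show "AE x in lborel. x \<in> {0<..} \<longrightarrow> norm (f x) \<le> norm (g x)"
    using assms(3) by (force intro: order_trans)
qed

lemma set_integrable_cauchy_kernel: "set_integrable lborel {0<..} (\<lambda>s::real. 1 / (1 + s\<^sup>2))"
  and integral_cauchy_kernel: "(LBINT s:{0<..}. 1 / (1 + s\<^sup>2)) = pi / 2"
proof -
  have lim: "((arctan \<circ> real_of_ereal) \<longlongrightarrow> 0) (at_right 0)"
    "((arctan \<circ> real_of_ereal) \<longlongrightarrow> pi / 2) (at_left \<infinity>)"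
    unfolding zero_ereal_def ereal_tendsto_simps by real_asymp+
  have *: "set_integrable lborel (einterval 0 \<infinity>) (\<lambda>s::real. 1 / (1 + s\<^sup>2))"
    by (rule interval_integral_FTC_nonneg(1)[OF _ _ _ _ lim])
      (auto intro!: derivative_eq_intros continuous_intros simp: field_simps add_nonneg_eq_0_iff)
  moreover have "(LBINT s=0..\<infinity>. 1 / (1 + s\<^sup>2)) = pi / 2 - 0"
    by (rule interval_integral_FTC_nonneg(2)[OF _ _ _ _ lim])
      (auto intro!: derivative_eq_intros continuous_intros simp: field_simps add_nonneg_eq_0_iff)
  moreover have "einterval 0 \<infinity> = {0::real<..}" by (auto simp: einterval_def)
  ultimately show "set_integrable lborel {0<..} (\<lambda>s::real. 1 / (1 + s\<^sup>2))"
    "(LBINT s:{0<..}. 1 / (1 + s\<^sup>2)) = pi / 2"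
    by (simp_all add: interval_lebesgue_integral_0_infty)
qed

text \<open>
  Up to constants this is, through inverse_one_plus_square_le, an integrable majorant both for
  ln (1 + s) / (1 + s^2) and for the density of the integral r.
\<close>
lemma set_integrable_minus_three_halves:
  "set_integrable lborel {0<..} (\<lambda>s::real. 1 / ((1 + s) * sqrt (1 + s)))"
proof -
  have *: "set_integrable lborel (einterval 0 \<infinity>) (\<lambda>s::real. 1 / ((1 + s) * sqrt (1 + s)))"
  proof (rule interval_integral_FTC_nonneg[where F = "\<lambda>s. - 2 / sqrt (1 + s)" and A = "-2" and B = 0])
    show "(((\<lambda>s. - 2 / sqrt (1 + s)) \<circ> real_of_ereal) \<longlongrightarrow> -2) (at_right 0)"
      unfolding zero_ereal_def ereal_tendsto_simps by real_asymp
    show "(((\<lambda>s. - 2 / sqrt (1 + s)) \<circ> real_of_ereal) \<longlongrightarrow> 0) (at_left \<infinity>)"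
      unfolding ereal_tendsto_simps by real_asymp
  qed (auto intro!: derivative_eq_intros continuous_intros simp: field_simps add_nonneg_eq_0_iff)
  have "einterval 0 \<infinity> = {0::real<..}" by (auto simp: einterval_def)
  with * show ?thesis by simp
qed

lemma inverse_one_plus_square_le:
  assumes "(s::real) > 0"
  shows "sqrt (1 + s) / (1 + s\<^sup>2) \<le> 2 * (1 / ((1 + s) * sqrt (1 + s)))"
proof -
  have "(1 + s)\<^sup>2 \<le> 2 * (1 + s\<^sup>2)"
    using zero_le_power2[of "1 - s"] by (simp add: power2_eq_square algebra_simps)
  moreover have "sqrt (1 + s) * ((1 + s) * sqrt (1 + s)) = (1 + s)\<^sup>2"
    using assms by (simp add: power2_eq_square flip: mult.assoc)
  moreover have "(1 + s) * sqrt (1 + s) > 0" "1 + s\<^sup>2 > 0"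
    using assms by (auto intro!: mult_pos_pos add_pos_nonneg)
  ultimately show ?thesis
    by (simp add: pos_divide_le_eq pos_le_divide_eq mult_ac)
qed

lemma set_integrable_ln_cauchy_kernel:
  "set_integrable lborel {0<..} (\<lambda>s::real. ln (1 + s) / (1 + s\<^sup>2))"
proof (rule set_integrable_half_line_mono)
  show "set_integrable lborel {0<..} (\<lambda>s::real. 4 * (1 / ((1 + s) * sqrt (1 + s))))"
    by (intro set_integrable_mult_right set_integrable_minus_three_halves)
  show "continuous_on {0<..} (\<lambda>s::real. ln (1 + s) / (1 + s\<^sup>2))"
    by (auto intro!: continuous_intros simp: add_nonneg_eq_0_iff)
  fix s :: real assume s: "s > 0"
  have "ln (1 + s) = 2 * ln (sqrt (1 + s))" using s by (simp add: ln_sqrt)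
  also have "\<dots> \<le> 2 * sqrt (1 + s)" using s ln_le_minus_one[of "sqrt (1+s)"] by simp
  finally have "ln (1 + s) / (1 + s\<^sup>2) \<le> 2 * sqrt (1 + s) / (1 + s\<^sup>2)"
    by (rule divide_right_mono) simp
  also have "\<dots> \<le> 4 * (1 / ((1 + s) * sqrt (1 + s)))"
    using inverse_one_plus_square_le[OF s] by simp
  finally show "norm (ln (1 + s) / (1 + s\<^sup>2)) \<le> 4 * (1 / ((1 + s) * sqrt (1 + s)))"
    using s by simp
qed

section \<open>The function B and its derivative\<close>

lemma slit_plane_add:
  assumes "z \<notin> \<real>\<^sub>\<le>\<^sub>0" "s \<ge> 0"
  shows "z + complex_of_real s \<notin> \<real>\<^sub>\<le>\<^sub>0"
  using assms by (auto simp: complex_nonpos_Reals_iff)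

text \<open>
  The whole ray z + [0, \<infinity>) stays at a positive distance from 0, although z + s leaves every
  compact set. This makes the estimates for the integrand of B uniform in s.
\<close>
lemma slit_plane_dist:
  assumes "z \<notin> \<real>\<^sub>\<le>\<^sub>0"
  obtains d where "d > 0" "\<And>s. s \<ge> 0 \<Longrightarrow> d \<le> norm (z + complex_of_real s)"
proof -
  have "open (- \<real>\<^sub>\<le>\<^sub>0 :: complex set)" by (simp add: open_Compl)
  then obtain d where d: "d > 0" "ball z d \<subseteq> - \<real>\<^sub>\<le>\<^sub>0"
    using assms openE by (metis ComplI)
  have "d \<le> norm (z + complex_of_real s)" if "s \<ge> 0" for s
  proof (rule ccontr)
    assume "\<not> ?thesis"
    then have "- complex_of_real s \<in> ball z d" by (simp add: dist_norm)
    moreover have "- complex_of_real s \<in> \<real>\<^sub>\<le>\<^sub>0" using that by (simp add: complex_nonpos_Reals_iff)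
    ultimately show False using d by blast
  qed
  with d that show ?thesis by blast
qed

lemma one_plus_square_complex_neq_0 [simp]: "1 + (complex_of_real s)\<^sup>2 \<noteq> 0"
proof -
  have "1 + (complex_of_real s)\<^sup>2 = complex_of_real (1 + s\<^sup>2)" by simp
  also have "\<dots> \<noteq> 0" unfolding of_real_eq_0_iff by (simp add: add_nonneg_eq_0_iff)
  finally show ?thesis .
qed

text \<open>
  The reflected form of B has its integration range on the positive half-line, as log_potential
  does; the endpoint 0 is a null set.
\<close>
lemma B_eq:
  "B z = complex_of_real (1 / pi) *
     (LBINT s:{0<..}. Ln (z + complex_of_real s) / complex_of_real (1 + s\<^sup>2))"
proof -
  have "(LBINT s:{..0}. Ln (z - complex_of_real s) / complex_of_real (1 + s\<^sup>2)) =
        (LBINT s:{0..}. Ln (z + complex_of_real s) / complex_of_real (1 + s\<^sup>2))"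
    by (subst set_integral_reflect) (simp add: atLeast_def)
  also have "\<dots> = (LBINT s:{0<..}. Ln (z + complex_of_real s) / complex_of_real (1 + s\<^sup>2))"
    by (rule set_integral_discrete_difference[where X = "{0}"]) auto
  finally show ?thesis by (simp add: B_def)
qed

lemma B_integrable:
  assumes z: "z \<notin> \<real>\<^sub>\<le>\<^sub>0"
  shows "set_integrable lborel {0<..} (\<lambda>s. Ln (z + complex_of_real s) / complex_of_real (1 + s\<^sup>2))"
proof -
  from z obtain d where d: "d > 0" "\<And>s. s \<ge> 0 \<Longrightarrow> d \<le> norm (z + complex_of_real s)"
    using slit_plane_dist by blast
  \<comment> \<open>The summands of K account for the lower bound d of |z + s|, the part of its upper bound that
      depends on z, and the argument.\<close>
  define K where "K = \<bar>ln d\<bar> + ln (1 + norm z) + pi"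
  show ?thesis
  proof (rule set_integrable_half_line_mono)
    show "set_integrable lborel {0<..} (\<lambda>s. K * (1 / (1 + s\<^sup>2)) + ln (1 + s) / (1 + s\<^sup>2))"
      by (intro set_integral_add set_integrable_mult_right set_integrable_cauchy_kernel
          set_integrable_ln_cauchy_kernel)
    show "continuous_on {0<..} (\<lambda>s. Ln (z + complex_of_real s) / complex_of_real (1 + s\<^sup>2))"
      using slit_plane_add[OF z] by (auto intro!: continuous_intros)
    fix s :: real assume s: "s > 0"
    let ?w = "z + complex_of_real s"
    have pos: "norm ?w > 0" using d(1) d(2)[of s] s by linarith
    have "norm ?w \<le> norm z + s" using norm_triangle_ineq[of z "complex_of_real s"] s by simp
    also have "\<dots> \<le> (1 + norm z) * (1 + s)" using s by (simp add: algebra_simps)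
    finally have "ln (norm ?w) \<le> ln ((1 + norm z) * (1 + s))"
      using pos s by (subst ln_le_cancel_iff) (auto intro!: mult_pos_pos add_pos_nonneg)
    also have "\<dots> = ln (1 + norm z) + ln (1 + s)"
      using s by (intro ln_mult_pos) (auto intro: add_pos_nonneg)
    finally have "ln (norm ?w) \<le> ln (1 + norm z) + ln (1 + s)" .
    moreover have "ln d \<le> ln (norm ?w)" using d(1) d(2)[of s] s pos by (subst ln_le_cancel_iff) auto
    moreover have "0 \<le> ln (1 + norm z)" "0 \<le> ln (1 + s)" using s by simp_all
    moreover have "Re (Ln ?w) = ln (norm ?w)" using pos by simp
    ultimately have re: "\<bar>Re (Ln ?w)\<bar> \<le> \<bar>ln d\<bar> + ln (1 + norm z) + ln (1 + s)"
      by linarith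
    have im: "\<bar>Im (Ln ?w)\<bar> \<le> pi"
      using pos mpi_less_Im_Ln[of ?w] Im_Ln_le_pi[of ?w] by auto
    have "norm (Ln ?w) \<le> K + ln (1 + s)"
      using cmod_le[of "Ln ?w"] re im unfolding K_def by linarith
    then show "norm (Ln ?w / complex_of_real (1 + s\<^sup>2)) \<le> K * (1 / (1 + s\<^sup>2)) + ln (1 + s) / (1 + s\<^sup>2)"
      unfolding norm_divide norm_of_real
      by (simp add: divide_right_mono flip: add_divide_distrib)
  qed
qed

lemma B_of_real:
  assumes "t > 0"
  shows "B (complex_of_real t) = complex_of_real (log_potential t)"
proof -
  have "(LBINT s:{0<..}. Ln (complex_of_real t + complex_of_real s) / complex_of_real (1 + s\<^sup>2)) =
        (LBINT s:{0<..}. complex_of_real (ln (t + s) / (1 + s\<^sup>2)))"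
    using assms by (intro set_lebesgue_integral_cong) (auto simp: Ln_of_real simp flip: of_real_add)
  then show ?thesis
    unfolding B_eq log_potential_def set_integral_complex_of_real of_real_mult by simp
qed

lemma B_deriv_integrable:
  assumes z: "z \<notin> \<real>\<^sub>\<le>\<^sub>0"
  shows "set_integrable lborel {0<..}
    (\<lambda>s. 1 / ((z + complex_of_real s) * complex_of_real (1 + s\<^sup>2)))"
proof -
  from z obtain d where d: "d > 0" "\<And>s. s \<ge> 0 \<Longrightarrow> d \<le> norm (z + complex_of_real s)"
    using slit_plane_dist by blast
  show ?thesis
  proof (rule set_integrable_half_line_mono)
    show "set_integrable lborel {0<..} (\<lambda>s. (1 / d) * (1 / (1 + s\<^sup>2)))"
      by (intro set_integrable_mult_right set_integrable_cauchy_kernel)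
    show "continuous_on {0<..} (\<lambda>s. 1 / ((z + complex_of_real s) * complex_of_real (1 + s\<^sup>2)))"
      using slit_plane_add[OF z] by (auto intro!: continuous_intros) (metis less_imp_le nonpos_Reals_zero_I)
    fix s :: real assume s: "s > 0"
    have "norm (complex_of_real (1 + s\<^sup>2)) = 1 + s\<^sup>2"
      unfolding norm_of_real by simp
    then show "norm (1 / ((z + complex_of_real s) * complex_of_real (1 + s\<^sup>2))) \<le> (1 / d) * (1 / (1 + s\<^sup>2))"
      unfolding norm_divide norm_mult using d(1) d(2)[of s] s
      by (auto intro!: divide_left_mono mult_right_mono mult_pos_pos add_pos_nonneg)
  qed
qed

text \<open>
  The mean value inequality on the disc of radius |h| around z + s, where the derivative of
  the remainder is 1/w - 1/(z + s) and |w| \<ge> d/2. The bound does not depend on s, which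
  is what allows differentiation under the integral sign.
\<close>
lemma Ln_second_order_remainder:
  assumes d: "d > 0" "\<And>s. s \<ge> 0 \<Longrightarrow> d \<le> norm (z + complex_of_real s)"
    and z: "z \<notin> \<real>\<^sub>\<le>\<^sub>0" and h: "norm h \<le> d / 2" and s: "s \<ge> 0"
  shows "norm (Ln (z + h + complex_of_real s) - Ln (z + complex_of_real s)
           - h / (z + complex_of_real s)) \<le> 2 / d\<^sup>2 * (norm h)\<^sup>2"
proof -
  define a where "a = z + complex_of_real s"
  have slit: "w \<notin> \<real>\<^sub>\<le>\<^sub>0" if "norm (w - a) \<le> d / 2" for w
  proof
    assume w: "w \<in> \<real>\<^sub>\<le>\<^sub>0"
    then have "Im w = 0" "Re w \<le> 0" by (auto simp: complex_nonpos_Reals_iff)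
    then have "w - a = - (z + complex_of_real (s - Re w))"
      by (simp add: a_def complex_eq_iff)
    moreover have "d \<le> norm (z + complex_of_real (s - Re w))" using \<open>Re w \<le> 0\<close> s by (intro d) auto
    ultimately show False using that d(1) by (metis norm_minus_cancel field_sum_of_halves
        add_le_same_cancel1 le_add_same_cancel1 linorder_not_le order_trans half_gt_zero)
  qed
  have low: "norm w \<ge> d / 2" if "norm (w - a) \<le> d / 2" for w
    using that d(2)[OF s] norm_triangle_ineq2[of a "a - w"] by (simp add: a_def norm_minus_commute)
  have a: "a \<noteq> 0" using d(1) d(2)[OF s] by (auto simp: a_def)
  have "norm ((Ln (a + h) - (a + h) / a) - (Ln a - a / a)) \<le> (2 / d\<^sup>2 * norm h) * norm ((a + h) - a)"
  proof (rule field_differentiable_bound[where S = "cball a (norm h)" and f' = "\<lambda>w. 1 / w - 1 / a"])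
    fix w assume w: "w \<in> cball a (norm h)"
    then have wa: "norm (w - a) \<le> norm h" "norm (w - a) \<le> d / 2"
      using h by (auto simp: dist_norm norm_minus_commute)
    have w0: "w \<noteq> 0" using low[OF wa(2)] d(1) by auto
    show "((\<lambda>w. Ln w - w / a) has_field_derivative 1 / w - 1 / a) (at w within cball a (norm h))"
      using slit[OF wa(2)] w0 a by (auto intro!: derivative_eq_intros simp: field_simps)
    have "1 / w - 1 / a = (a - w) / (w * a)" using w0 a by (simp add: field_simps)
    then have "norm (1 / w - 1 / a) = norm (w - a) / (norm w * norm a)"
      by (simp add: norm_divide norm_mult norm_minus_commute)
    also have "\<dots> \<le> norm h / (d / 2 * d)"
      using low[OF wa(2)] d(1) d(2)[OF s] wa(1)
      by (intro frac_le mult_mono) (auto simp: a_def)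
    finally show "norm (1 / w - 1 / a) \<le> 2 / d\<^sup>2 * norm h"
      by (simp add: power2_eq_square mult_ac)
  qed (auto simp: dist_norm)
  moreover have "(Ln (a + h) - (a + h) / a) - (Ln a - a / a) = Ln (a + h) - Ln a - h / a"
    by (simp add: add_divide_distrib)
  moreover have "a + h = z + h + complex_of_real s" by (simp add: a_def)
  ultimately have "norm (Ln (z + h + complex_of_real s) - Ln a - h / a)
      \<le> (2 / d\<^sup>2 * norm h) * norm ((a + h) - a)"
    by metis
  then show ?thesis by (simp add: a_def power2_eq_square)
qed

text \<open>
  Integrating the second order remainder of the logarithm against the kernel 1 / (1 + s^2)
  leaves a remainder of order |h|^2 for B.
\<close>
lemma B_has_field_derivative_integral:
  assumes z: "z \<notin> \<real>\<^sub>\<le>\<^sub>0"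
  shows "(B has_field_derivative complex_of_real (1 / pi) *
    (LBINT s:{0<..}. 1 / ((z + complex_of_real s) * complex_of_real (1 + s\<^sup>2)))) (at z)"
    (is "(B has_field_derivative ?c * ?D) _")
proof -
  from z obtain d where d: "d > 0" "\<And>s. s \<ge> 0 \<Longrightarrow> d \<le> norm (z + complex_of_real s)"
    using slit_plane_dist by blast
  have bound: "norm ((B (z + h) - B z) - h * (?c * ?D)) \<le> (1 / d\<^sup>2) * (norm h)\<^sup>2"
    if h: "norm h \<le> d / 2" for h
  proof -
    have zh: "z + h \<notin> \<real>\<^sub>\<le>\<^sub>0"
    proof
      assume "z + h \<in> \<real>\<^sub>\<le>\<^sub>0"
      then have "h = - (z + complex_of_real (- Re (z + h)))" "Re (z + h) \<le> 0"
        by (auto simp: complex_nonpos_Reals_iff complex_eq_iff)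
      then have "d \<le> norm h" using d(2)[of "- Re (z + h)"] by (metis neg_0_le_iff_le norm_minus_cancel)
      then show False using h d(1) by linarith
    qed
    define R where "R = (\<lambda>s. Ln (z + h + complex_of_real s) / complex_of_real (1 + s\<^sup>2)
        - Ln (z + complex_of_real s) / complex_of_real (1 + s\<^sup>2)
        - h * (1 / ((z + complex_of_real s) * complex_of_real (1 + s\<^sup>2))))"
    have int: "set_integrable lborel {0<..} R"
      unfolding R_def
      by (intro set_integral_diff set_integrable_mult_right B_integrable zh z B_deriv_integrable)
    have "(LBINT s:{0<..}. R s) =
        (LBINT s:{0<..}. Ln (z + h + complex_of_real s) / complex_of_real (1 + s\<^sup>2)) -
        (LBINT s:{0<..}. Ln (z + complex_of_real s) / complex_of_real (1 + s\<^sup>2)) - h * ?D"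
      unfolding R_def set_integral_mult_right[symmetric]
      by (intro trans[OF set_integral_diff(2)] arg_cong2[where f = "(-)"] set_integral_diff(2)
          refl set_integral_diff(1) set_integrable_mult_right B_integrable zh z B_deriv_integrable)
    then have "(B (z + h) - B z) - h * (?c * ?D) = ?c * (LBINT s:{0<..}. R s)"
      unfolding B_eq by (simp only: right_diff_distrib mult_ac)
    then have "norm ((B (z + h) - B z) - h * (?c * ?D)) = 1 / pi * norm (LBINT s:{0<..}. R s)"
      by (simp add: norm_mult norm_divide)
    also have "norm (LBINT s:{0<..}. R s) \<le> (LBINT s:{0<..}. norm (R s))"
      by (rule set_integral_norm_bound[OF int])
    also have "\<dots> \<le> (LBINT s:{0<..}. (2 / d\<^sup>2 * (norm h)\<^sup>2) * (1 / (1 + s\<^sup>2)))"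
    proof (rule set_integral_mono)
      show "set_integrable lborel {0<..} (\<lambda>s. norm (R s))" by (rule set_integrable_norm[OF int])
      show "set_integrable lborel {0<..} (\<lambda>s. (2 / d\<^sup>2 * (norm h)\<^sup>2) * (1 / (1 + s\<^sup>2)))"
        by (intro set_integrable_mult_right set_integrable_cauchy_kernel)
      fix s :: real assume s: "s \<in> {0<..}"
      have "R s = (Ln (z + h + complex_of_real s) - Ln (z + complex_of_real s)
           - h / (z + complex_of_real s)) / complex_of_real (1 + s\<^sup>2)"
        by (simp add: R_def diff_divide_distrib)
      moreover have "norm (complex_of_real (1 + s\<^sup>2)) = 1 + s\<^sup>2"
        unfolding norm_of_real by simp
      ultimately show "norm (R s) \<le> (2 / d\<^sup>2 * (norm h)\<^sup>2) * (1 / (1 + s\<^sup>2))"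
        using divide_right_mono[OF Ln_second_order_remainder[OF d z h, of s], of "1 + s\<^sup>2"] s
        by (simp add: norm_divide del: of_real_add)
    qed
    also have "\<dots> = (2 / d\<^sup>2 * (norm h)\<^sup>2) * (pi / 2)"
      unfolding set_integral_mult_right integral_cauchy_kernel ..
    finally show ?thesis by (simp add: mult_left_mono field_simps)
  qed
  have "((\<lambda>h. (B (z + h) - B z) / h - ?c * ?D) \<longlongrightarrow> 0) (at 0)"
  proof (rule Lim_null_comparison)
    show "eventually (\<lambda>h. norm ((B (z + h) - B z) / h - ?c * ?D) \<le> (1 / d\<^sup>2) * norm h) (at 0)"
      unfolding eventually_at
    proof (intro exI[of _ "d/2"] conjI ballI impI)
      fix h :: complex assume h: "h \<noteq> 0 \<and> dist h 0 < d / 2"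
      have "(B (z + h) - B z) / h - ?c * ?D = ((B (z + h) - B z) - h * (?c * ?D)) / h"
        using h by (simp add: field_simps)
      then have "norm ((B (z + h) - B z) / h - ?c * ?D) * norm h \<le> (1 / d\<^sup>2 * norm h) * norm h"
        using bound[of h] h by (simp add: norm_divide power2_eq_square)
      then show "norm ((B (z + h) - B z) / h - ?c * ?D) \<le> (1 / d\<^sup>2) * norm h"
        by (rule mult_right_le_imp_le) (use h in simp)
    qed (use d in auto)
    have "((\<lambda>h::complex. (1 / d\<^sup>2) * norm h) \<longlongrightarrow> (1 / d\<^sup>2) * norm (0::complex)) (at 0)"
      by (intro tendsto_intros)
    then show "((\<lambda>h::complex. (1 / d\<^sup>2) * norm h) \<longlongrightarrow> 0) (at 0)" by simp
  qed
  then show ?thesis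
    unfolding DERIV_def by (subst (asm) LIM_zero_iff)
qed

text \<open>
  Dividing by the positive number (1 + s^2)^(1/2) inside the logarithm turns the difference
  into Log of a quantity that tends to 1.
\<close>
lemma tendsto_Ln_add_minus_ln:
  "((\<lambda>s. Ln (z + complex_of_real s) - complex_of_real (ln (1 + s\<^sup>2) / 2)) \<longlongrightarrow> 0) at_top"
proof -
  have "((\<lambda>s. z * complex_of_real (1 / sqrt (1 + s\<^sup>2)) + complex_of_real (s / sqrt (1 + s\<^sup>2)))
      \<longlongrightarrow> z * complex_of_real 0 + complex_of_real 1) at_top"
    by (intro tendsto_intros tendsto_of_real; real_asymp)
  then have "((\<lambda>s. Ln (z * complex_of_real (1 / sqrt (1 + s\<^sup>2)) + complex_of_real (s / sqrt (1 + s\<^sup>2))))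
      \<longlongrightarrow> Ln 1) at_top"
    by (intro tendsto_Ln) simp_all
  moreover have "eventually (\<lambda>s. Ln (z * complex_of_real (1 / sqrt (1 + s\<^sup>2)) + complex_of_real (s / sqrt (1 + s\<^sup>2)))
      = Ln (z + complex_of_real s) - complex_of_real (ln (1 + s\<^sup>2) / 2)) at_top"
    using eventually_gt_at_top[of "norm z"]
  proof eventually_elim
    case (elim s)
    have pos: "sqrt (1 + s\<^sup>2) > 0" by (simp add: add_pos_nonneg)
    have "z + complex_of_real s \<noteq> 0"
      using elim by (metis abs_of_nonneg add_eq_0_iff less_eq_real_def less_irrefl norm_ge_zero
          norm_minus_cancel norm_of_real order.trans)
    then have "Ln ((z + complex_of_real s) / complex_of_real (sqrt (1 + s\<^sup>2)))
        = Ln (z + complex_of_real s) - complex_of_real (ln (sqrt (1 + s\<^sup>2)))"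
      using Ln_divide_of_real[OF pos] by blast
    moreover have "ln (sqrt (1 + s\<^sup>2)) = ln (1 + s\<^sup>2) / 2"
      by (rule ln_sqrt) (simp add: add_pos_nonneg)
    ultimately show ?case by (simp add: add_divide_distrib)
  qed
  ultimately show ?thesis
    unfolding Ln_1 by (rule Lim_transform_eventually)
qed

text \<open>
  By partial fractions 1 / ((z + s) (1 + s^2)) is (1 + z^2)^(-1) times
  1/(z + s) + (z - s)/(1 + s^2), so an explicit primitive in s is available. The points \<plusminus>i, at
  which the formula degenerates, are removable singularities.
\<close>
lemma B_has_field_derivative:
  assumes z: "z \<notin> \<real>\<^sub>\<le>\<^sub>0" and nz: "1 + z\<^sup>2 \<noteq> 0"
  shows "(B has_field_derivative (z / 2 - Ln z / complex_of_real pi) / (1 + z\<^sup>2)) (at z)"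
proof -
  define P where "P = (\<lambda>s. (Ln (z + complex_of_real s) - complex_of_real (ln (1 + s\<^sup>2) / 2)
      + z * complex_of_real (arctan s)) / (1 + z\<^sup>2))"
  have "(LBINT s=0..\<infinity>. 1 / ((z + complex_of_real s) * complex_of_real (1 + s\<^sup>2)))
      = z * complex_of_real (pi / 2) / (1 + z\<^sup>2) - Ln z / (1 + z\<^sup>2)"
  proof (rule interval_integral_FTC_integrable[where F = P])
    fix s :: real assume "0 < ereal s"
    then have s: "s > 0" by simp
    have slit: "z + complex_of_real s \<notin> \<real>\<^sub>\<le>\<^sub>0" using slit_plane_add[OF z] s by simp
    then have zs: "z + complex_of_real s \<noteq> 0" by auto
    have "((\<lambda>w. Ln (z + w)) has_field_derivative 1 / (z + complex_of_real s)) (at (complex_of_real s))"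
      using slit zs by (auto intro!: derivative_eq_intros simp: field_simps)
    then have 1: "((\<lambda>x. Ln (z + complex_of_real x)) has_vector_derivative 1 / (z + complex_of_real s)) (at s)"
      by (rule has_vector_derivative_real_field)
    have "((\<lambda>x. ln (1 + x\<^sup>2) / 2) has_real_derivative s / (1 + s\<^sup>2)) (at s)"
      by (rule derivative_eq_intros refl | simp add: add_pos_nonneg add_nonneg_eq_0_iff frac_eq_eq)+
    then have 2: "((\<lambda>x. complex_of_real (ln (1 + x\<^sup>2) / 2)) has_vector_derivative
        complex_of_real (s / (1 + s\<^sup>2))) (at s)"
      by (rule has_vector_derivative_of_real)
    have "(arctan has_real_derivative 1 / (1 + s\<^sup>2)) (at s)"
      by (auto intro!: derivative_eq_intros simp: divide_inverse)
    then have 3: "((\<lambda>x. complex_of_real (arctan x)) has_vector_derivative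
        complex_of_real (1 / (1 + s\<^sup>2))) (at s)"
      by (rule has_vector_derivative_of_real)
    have "(P has_vector_derivative (1 / (z + complex_of_real s) - complex_of_real (s / (1 + s\<^sup>2))
        + z * complex_of_real (1 / (1 + s\<^sup>2))) / (1 + z\<^sup>2)) (at s)"
      unfolding P_def by (intro derivative_intros 1 2 3)
    moreover have "(1 / (z + complex_of_real s) - complex_of_real (s / (1 + s\<^sup>2))
        + z * complex_of_real (1 / (1 + s\<^sup>2))) / (1 + z\<^sup>2)
        = 1 / ((z + complex_of_real s) * complex_of_real (1 + s\<^sup>2))"
    proof -
      let ?S = "complex_of_real s"
      have "1 / (z + ?S) - ?S / (1 + ?S\<^sup>2) + z * (1 / (1 + ?S\<^sup>2)) = 1 / (z + ?S) + (z - ?S) / (1 + ?S\<^sup>2)"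
        by (simp add: diff_divide_distrib)
      also have "\<dots> = ((1 + ?S\<^sup>2) + (z - ?S) * (z + ?S)) / ((z + ?S) * (1 + ?S\<^sup>2))"
        using zs by (subst add_frac_eq) (simp_all add: mult_ac)
      also have "(1 + ?S\<^sup>2) + (z - ?S) * (z + ?S) = 1 + z\<^sup>2"
        by (simp add: power2_eq_square algebra_simps)
      finally show ?thesis using nz by simp
    qed
    ultimately show "(P has_vector_derivative 1 / ((z + complex_of_real s) * complex_of_real (1 + s\<^sup>2))) (at s)"
      by metis
    show "isCont (\<lambda>s. 1 / ((z + complex_of_real s) * complex_of_real (1 + s\<^sup>2))) s"
      using zs by (auto intro!: continuous_intros)
  next
    have "einterval 0 \<infinity> = {0::real<..}" by (auto simp: einterval_def)
    then show "set_integrable lborel (einterval 0 \<infinity>)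
        (\<lambda>s. 1 / ((z + complex_of_real s) * complex_of_real (1 + s\<^sup>2)))"
      using B_deriv_integrable[OF z] by simp
  next
    have "isCont P 0"
      unfolding P_def using z nz by (auto intro!: continuous_intros simp: add_nonneg_eq_0_iff)
    then have "(P \<longlongrightarrow> P 0) (at_right 0)"
      by (simp add: isCont_def filterlim_at_split)
    then show "((P \<circ> real_of_ereal) \<longlongrightarrow> Ln z / (1 + z\<^sup>2)) (at_right 0)"
      unfolding zero_ereal_def ereal_tendsto_simps by (simp add: P_def)
  next
    have "((\<lambda>s. complex_of_real (arctan s)) \<longlongrightarrow> complex_of_real (pi / 2)) at_top"
      by (intro tendsto_of_real) real_asymp
    then have "(P \<longlongrightarrow> (0 + z * complex_of_real (pi / 2)) / (1 + z\<^sup>2)) at_top"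
      unfolding P_def using nz
      by (intro tendsto_divide tendsto_add tendsto_mult tendsto_const tendsto_Ln_add_minus_ln)
    then show "((P \<circ> real_of_ereal) \<longlongrightarrow> z * complex_of_real (pi / 2) / (1 + z\<^sup>2)) (at_left \<infinity>)"
      unfolding ereal_tendsto_simps by simp
  qed simp
  then have "complex_of_real (1 / pi) *
      (LBINT s:{0<..}. 1 / ((z + complex_of_real s) * complex_of_real (1 + s\<^sup>2)))
      = (z / 2 - Ln z / complex_of_real pi) / (1 + z\<^sup>2)"
    unfolding interval_lebesgue_integral_0_infty
    by (simp only:) (simp add: right_diff_distrib diff_divide_distrib)
  with B_has_field_derivative_integral[OF z] show ?thesis by simp
qed

lemma B_holomorphic [holomorphic_intros]:
  assumes "f holomorphic_on A" "\<And>w. w \<in> A \<Longrightarrow> f w \<notin> \<real>\<^sub>\<le>\<^sub>0"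
  shows "(\<lambda>w. B (f w)) holomorphic_on A"
proof -
  have "B holomorphic_on (- \<real>\<^sub>\<le>\<^sub>0)"
    unfolding holomorphic_on_def field_differentiable_def
    using B_has_field_derivative_integral has_field_derivative_at_within by blast
  then have "B \<circ> f holomorphic_on A"
    using assms by (intro holomorphic_on_compose_gen[of f A B "- \<real>\<^sub>\<le>\<^sub>0"]) auto
  then show ?thesis by (simp add: o_def)
qed

section \<open>Growth of exp B in the right half-plane\<close>

lemma Re_B:
  assumes "z \<notin> \<real>\<^sub>\<le>\<^sub>0"
  shows "set_integrable lborel {0<..} (\<lambda>s. ln (norm (z + complex_of_real s)) / (1 + s\<^sup>2))"
    and "Re (B z) = 1 / pi * (LBINT s:{0<..}. ln (norm (z + complex_of_real s)) / (1 + s\<^sup>2))"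
proof -
  have *: "Re (indicator {0<..} s *\<^sub>R (Ln (z + complex_of_real s) / complex_of_real (1 + s\<^sup>2)))
      = indicator {0<..} s *\<^sub>R (ln (norm (z + complex_of_real s)) / (1 + s\<^sup>2))" for s
    using slit_plane_add[OF assms, of s]
    by (cases "z + complex_of_real s = 0") (auto simp: indicator_def simp del: of_real_add)
  have int: "integrable lborel (\<lambda>s. indicator {0<..} s *\<^sub>R
      (Ln (z + complex_of_real s) / complex_of_real (1 + s\<^sup>2)))"
    using B_integrable[OF assms] unfolding set_integrable_def .
  show "set_integrable lborel {0<..} (\<lambda>s. ln (norm (z + complex_of_real s)) / (1 + s\<^sup>2))"
    using integrable_Re[OF int] unfolding * set_integrable_def .
  show "Re (B z) = 1 / pi * (LBINT s:{0<..}. ln (norm (z + complex_of_real s)) / (1 + s\<^sup>2))"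
    unfolding B_eq set_lebesgue_integral_def *[symmetric] integral_Re[OF int]
    by (simp del: of_real_add)
qed

lemma B_cnj:
  assumes "z \<notin> \<real>\<^sub>\<le>\<^sub>0"
  shows "B (cnj z) = cnj (B z)"
proof -
  have "indicator {0<..} s *\<^sub>R (Ln (cnj z + complex_of_real s) / complex_of_real (1 + s\<^sup>2))
      = cnj (indicator {0<..} s *\<^sub>R (Ln (z + complex_of_real s) / complex_of_real (1 + s\<^sup>2)))" for s
  proof (cases "s > 0")
    case True
    have "Ln (cnj (z + complex_of_real s)) = cnj (Ln (z + complex_of_real s))"
      using slit_plane_add[OF assms, of s] True by (intro cnj_Ln[symmetric]) auto
    then show ?thesis using True by simp
  qed auto
  then have "(LBINT s. indicator {0<..} s *\<^sub>R (Ln (cnj z + complex_of_real s) / complex_of_real (1 + s\<^sup>2)))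
      = (LBINT s. cnj (indicator {0<..} s *\<^sub>R (Ln (z + complex_of_real s) / complex_of_real (1 + s\<^sup>2))))"
    by (rule Bochner_Integration.integral_cong[OF refl])
  then show ?thesis
    unfolding B_eq set_lebesgue_integral_def Bochner_Integration.integral_cnj by simp
qed

lemma half_plane_not_nonpos_Real: "Re z \<ge> 0 \<Longrightarrow> z \<noteq> 0 \<Longrightarrow> z \<notin> \<real>\<^sub>\<le>\<^sub>0"
  by (auto simp: complex_nonpos_Reals_iff complex_eq_iff)

lemma norm_add_of_real_ge:
  assumes "Re z \<ge> 0" "s \<ge> 0"
  shows "norm z \<le> norm (z + complex_of_real s)"
  unfolding cmod_def using assms by (intro real_sqrt_le_mono add_right_mono power_mono) auto

text \<open>
  Moving to the right from a point of the closed right half-plane increases the modulus, so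
  Re B(z) is at least ln |z| times 1/2, the total mass of the kernel 1 / (\<pi> (1 + s^2)).
\<close>
lemma norm_exp_minus_B_le:
  assumes "Re z \<ge> 0" "z \<noteq> 0"
  shows "norm (exp (- B z)) \<le> 1 / sqrt (norm z)"
proof -
  note slit = half_plane_not_nonpos_Real[OF assms]
  have "ln (norm z) / 2 = 1 / pi * (LBINT s:{0<..}. ln (norm z) * (1 / (1 + s\<^sup>2)))"
    unfolding set_integral_mult_right integral_cauchy_kernel by simp
  also have "\<dots> \<le> Re (B z)"
    unfolding Re_B(2)[OF slit]
  proof (intro mult_left_mono set_integral_mono Re_B(1)[OF slit] set_integrable_mult_right
      set_integrable_cauchy_kernel)
    fix s :: real assume "s \<in> {0<..}"
    then have "ln (norm z) \<le> ln (norm (z + complex_of_real s))"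
      using assms norm_add_of_real_ge[OF assms(1), of s] by (intro ln_mono) auto
    then show "ln (norm z) * (1 / (1 + s\<^sup>2)) \<le> ln (norm (z + complex_of_real s)) / (1 + s\<^sup>2)"
      by (simp add: divide_right_mono)
  qed simp
  finally have "exp (- Re (B z)) \<le> exp (- (ln (sqrt (norm z))))"
    using assms by (simp add: ln_sqrt)
  also have "\<dots> = 1 / sqrt (norm z)" using assms by (simp add: exp_minus field_simps)
  finally show ?thesis by simp
qed

text \<open>
  Here |z + s| \<le> (1 + |z|) (1 + s) separates the variables; the constant comes from the
  integral of ln (1 + s) against the kernel.
\<close>
lemma norm_exp_B_le:
  obtains C where "C > 0"
    "\<And>z. Re z \<ge> 0 \<Longrightarrow> z \<noteq> 0 \<Longrightarrow> norm (exp (B z)) \<le> C * sqrt (1 + norm z)"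
proof -
  define K where "K = 1 / pi * (LBINT s:{0<..}. ln (1 + s) / (1 + s\<^sup>2))"
  have "norm (exp (B z)) \<le> exp K * sqrt (1 + norm z)" if z: "Re z \<ge> 0" "z \<noteq> 0" for z
  proof -
    note slit = half_plane_not_nonpos_Real[OF z]
    have "Re (B z) \<le> 1 / pi * (LBINT s:{0<..}. ln (1 + norm z) * (1 / (1 + s\<^sup>2)) + ln (1 + s) / (1 + s\<^sup>2))"
      unfolding Re_B(2)[OF slit]
    proof (intro mult_left_mono set_integral_mono set_integral_add Re_B(1)[OF slit]
        set_integrable_mult_right set_integrable_cauchy_kernel set_integrable_ln_cauchy_kernel)
      fix s :: real assume s: "s \<in> {0<..}"
      have "norm (z + complex_of_real s) \<le> norm z + s"
        using norm_triangle_ineq[of z "complex_of_real s"] s by simp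
      also have "\<dots> \<le> (1 + norm z) * (1 + s)" using s by (simp add: algebra_simps)
      finally have "norm (z + complex_of_real s) \<le> (1 + norm z) * (1 + s)" .
      moreover have "norm (z + complex_of_real s) > 0"
        using norm_add_of_real_ge[OF z(1), of s] z s by (smt (verit) greaterThan_iff zero_less_norm_iff)
      ultimately have "ln (norm (z + complex_of_real s)) \<le> ln ((1 + norm z) * (1 + s))"
        by (intro ln_mono) auto
      also have "\<dots> = ln (1 + norm z) + ln (1 + s)"
        using s by (intro ln_mult_pos) (auto intro: add_pos_nonneg)
      finally show "ln (norm (z + complex_of_real s)) / (1 + s\<^sup>2)
          \<le> ln (1 + norm z) * (1 / (1 + s\<^sup>2)) + ln (1 + s) / (1 + s\<^sup>2)"
        by (simp add: divide_right_mono flip: add_divide_distrib)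
    qed simp
    also have "\<dots> = ln (1 + norm z) / 2 + K"
      unfolding K_def
      by (subst set_integral_add)
        (auto simp only: set_integral_mult_right integral_cauchy_kernel distrib_left
          intro!: set_integrable_mult_right set_integrable_cauchy_kernel set_integrable_ln_cauchy_kernel, simp)
    also have "ln (1 + norm z) / 2 = ln (sqrt (1 + norm z))"
      by (simp add: ln_sqrt add_pos_nonneg)
    finally have "exp (Re (B z)) \<le> exp (ln (sqrt (1 + norm z)) + K)" by simp
    also have "\<dots> = exp K * sqrt (1 + norm z)"
      unfolding exp_add by (simp add: add_pos_nonneg)
    finally show ?thesis by simp
  qed
  then show ?thesis using that[of "exp K"] by simp
qed

section \<open>The reflection formula\<close>

lemma upper_half_plane_not_nonpos_Real: "Im z > 0 \<Longrightarrow> z \<notin> \<real>\<^sub>\<le>\<^sub>0"  "Im z > 0 \<Longrightarrow> - z \<notin> \<real>\<^sub>\<le>\<^sub>0"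
  by (auto simp: complex_nonpos_Reals_iff)

lemma ln_one_plus_square_div_bound:
  assumes "y \<ge> 1" "s > 0"
  shows "norm (ln (1 + (s / y)\<^sup>2) / (1 + s\<^sup>2)) \<le> 2 * (ln (1 + s) / (1 + s\<^sup>2))"
proof -
  have "s / y \<le> s" using assms by (simp add: divide_le_eq)
  then have "(s / y)\<^sup>2 \<le> s\<^sup>2" using assms by (intro power_mono) auto
  then have "1 + (s / y)\<^sup>2 \<le> (1 + s)\<^sup>2" using assms by (simp add: power2_eq_square algebra_simps)
  then have "ln (1 + (s / y)\<^sup>2) \<le> ln ((1 + s)\<^sup>2)" by (intro ln_mono) (auto simp: add_pos_nonneg)
  also have "\<dots> = 2 * ln (1 + s)" using assms by (simp add: ln_realpow)
  finally have "ln (1 + (s / y)\<^sup>2) / (1 + s\<^sup>2) \<le> 2 * ln (1 + s) / (1 + s\<^sup>2)"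
    by (rule divide_right_mono) simp
  moreover have "ln (1 + (s / y)\<^sup>2) \<ge> 0" by simp
  ultimately show ?thesis by simp
qed

text \<open>
  The sum B(iy) + B(-iy) is the integral of ln (y^2 + s^2) against the kernel 1 / (\<pi> (1 + s^2)),
  which is ln y plus the integral of ln (1 + (s/y)^2). The latter tends to 0 by dominated convergence.
\<close>
lemma tendsto_exp_B_imaginary_axis:
  "((\<lambda>y. exp (B (\<i> * complex_of_real y) + B (- (\<i> * complex_of_real y))) / (1 + complex_of_real y)) \<longlongrightarrow> 1) at_top"
proof -
  define e where "e = (\<lambda>y::real. LBINT s:{0<..}. ln (1 + (s / y)\<^sup>2) / (1 + s\<^sup>2))"
  have int2: "set_integrable lborel {0<..} (\<lambda>s::real. 2 * (ln (1 + s) / (1 + s\<^sup>2)))"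
    by (intro set_integrable_mult_right set_integrable_ln_cauchy_kernel)
  have int_e: "set_integrable lborel {0<..} (\<lambda>s::real. ln (1 + (s / y)\<^sup>2) / (1 + s\<^sup>2))" if "y \<ge> 1" for y
    by (rule set_integrable_half_line_mono[OF int2 _ ln_one_plus_square_div_bound[OF that]])
      (use that in \<open>auto intro!: continuous_intros simp: add_nonneg_eq_0_iff\<close>)
  have lim_e: "(e \<longlongrightarrow> (LBINT s:{0::real<..}. 0)) at_top"
    unfolding e_def set_lebesgue_integral_def
  proof (rule integral_dominated_convergence_at_top)
    show "(\<lambda>s::real. indicator {0<..} s *\<^sub>R (ln (1 + (s / y)\<^sup>2) / (1 + s\<^sup>2))) \<in> borel_measurable lborel" for y
      by measurable
    show "(\<lambda>s::real. indicator {0<..} s *\<^sub>R (0::real)) \<in> borel_measurable lborel" by measurable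
    show "integrable lborel (\<lambda>s::real. indicator {0<..} s *\<^sub>R (2 * (ln (1 + s) / (1 + s\<^sup>2))))"
      using int2 unfolding set_integrable_def .
    have "((\<lambda>y. ln (1 + (s / y)\<^sup>2) / (1 + s\<^sup>2)) \<longlongrightarrow> 0) at_top" for s :: real
    proof -
      have "((\<lambda>y. ln (1 + (s / y)\<^sup>2) / (1 + s\<^sup>2)) \<longlongrightarrow> ln (1 + 0\<^sup>2) / (1 + s\<^sup>2)) at_top"
        by (intro tendsto_intros tendsto_divide_0[OF tendsto_const])
          (auto simp: filterlim_ident add_nonneg_eq_0_iff intro: filterlim_at_top_imp_at_infinity)
      then show ?thesis by simp
    qed
    then show "AE s in lborel. ((\<lambda>y::real. indicator {0<..} s *\<^sub>R (ln (1 + (s / y)\<^sup>2) / (1 + s\<^sup>2))) \<longlongrightarrow>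
        indicator {0<..} s *\<^sub>R 0) at_top"
      by (intro AE_I2 tendsto_intros)
    show "\<forall>\<^sub>F y in at_top. AE s in lborel. norm (indicator {0<..} s *\<^sub>R (ln (1 + (s / y)\<^sup>2) / (1 + s\<^sup>2)))
        \<le> indicator {0<..} s *\<^sub>R (2 * (ln (1 + s) / (1 + s\<^sup>2)))"
      using eventually_ge_at_top[of "1::real"]
    proof eventually_elim
      case (elim y)
      show ?case
      proof (intro AE_I2)
        show "norm (indicator {0<..} s *\<^sub>R (ln (1 + (s / y)\<^sup>2) / (1 + s\<^sup>2)))
          \<le> indicator {0<..} s *\<^sub>R (2 * (ln (1 + s) / (1 + s\<^sup>2)))" for s
          using ln_one_plus_square_div_bound[OF elim, of s] by (cases "s > 0") simp_all
      qed
    qed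
  qed
  have e_zero: "(LBINT s:{0::real<..}. 0::real) = 0" by (simp add: set_lebesgue_integral_def)
  have lim_frac: "((\<lambda>y::real. y / (1 + y)) \<longlongrightarrow> 1) at_top" by real_asymp
  have "((\<lambda>y. complex_of_real (y / (1 + y) * exp (e y / pi))) \<longlongrightarrow> complex_of_real (1 * exp (0 / pi))) at_top"
    using lim_e unfolding e_zero
    by (intro tendsto_of_real tendsto_mult tendsto_exp tendsto_divide tendsto_const lim_frac) simp_all
  moreover have "eventually (\<lambda>y. complex_of_real (y / (1 + y) * exp (e y / pi)) =
     exp (B (\<i> * complex_of_real y) + B (- (\<i> * complex_of_real y))) / (1 + complex_of_real y)) at_top"
    using eventually_ge_at_top[of "1::real"]
  proof eventually_elim
    case (elim y)
    let ?z = "\<i> * complex_of_real y"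
    have slit: "?z \<notin> \<real>\<^sub>\<le>\<^sub>0" using elim by (simp add: complex_nonpos_Reals_iff)
    have "B (- ?z) = cnj (B ?z)" using B_cnj[OF slit] by simp
    then have "B ?z + B (- ?z) = complex_of_real (2 * Re (B ?z))" by (simp add: complex_add_cnj)
    also have "2 * Re (B ?z) = 1 / pi * (LBINT s:{0<..}. 2 * (ln (norm (?z + complex_of_real s)) / (1 + s\<^sup>2)))"
      unfolding Re_B(2)[OF slit] set_integral_mult_right by simp
    also have "(LBINT s:{0<..}. 2 * (ln (norm (?z + complex_of_real s)) / (1 + s\<^sup>2))) =
        (LBINT s:{0<..}. 2 * ln y * (1 / (1 + s\<^sup>2)) + ln (1 + (s / y)\<^sup>2) / (1 + s\<^sup>2))"
    proof (intro set_lebesgue_integral_cong allI impI)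
      fix s :: real assume "s \<in> {0<..}"
      have "(norm (?z + complex_of_real s))\<^sup>2 = y\<^sup>2 * (1 + (s / y)\<^sup>2)"
        using elim by (simp add: cmod_power2 field_simps)
      moreover have "norm (?z + complex_of_real s) > 0" using elim by (auto simp: complex_eq_iff)
      ultimately have "2 * ln (norm (?z + complex_of_real s)) = ln (y\<^sup>2 * (1 + (s / y)\<^sup>2))"
        by (metis ln_realpow of_nat_numeral)
      also have "\<dots> = 2 * ln y + ln (1 + (s / y)\<^sup>2)"
        using elim by (subst ln_mult_pos) (auto simp: ln_realpow add_pos_nonneg)
      finally have "2 * ln (norm (?z + complex_of_real s)) / (1 + s\<^sup>2)
          = (2 * ln y + ln (1 + (s / y)\<^sup>2)) / (1 + s\<^sup>2)" by simp
      then show "2 * (ln (norm (?z + complex_of_real s)) / (1 + s\<^sup>2))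
          = 2 * ln y * (1 / (1 + s\<^sup>2)) + ln (1 + (s / y)\<^sup>2) / (1 + s\<^sup>2)"
        by (simp add: add_divide_distrib)
    qed simp
    also have "\<dots> = (LBINT s:{0<..}. 2 * ln y * (1 / (1 + s\<^sup>2))) + e y"
      unfolding e_def
      by (intro set_integral_add(2) set_integrable_mult_right set_integrable_cauchy_kernel int_e elim)
    also have "(LBINT s:{0<..}. 2 * ln y * (1 / (1 + s\<^sup>2))) = pi * ln y"
      unfolding set_integral_mult_right integral_cauchy_kernel by simp
    finally have "B ?z + B (- ?z) = complex_of_real (ln y + e y / pi)"
      by (simp add: field_simps)
    then have "exp (B ?z + B (- ?z)) = complex_of_real (y * exp (e y / pi))"
      using elim by (simp only: exp_of_real) (simp add: exp_add)
    then show ?case by simp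
  qed
  ultimately show ?thesis
    by (simp add: Lim_transform_eventually)
qed

text \<open>
  The quotient of the two sides is constant on the upper half-plane because
  B'(z) - B'(-z) = 1 / (z + i): the terms with Log combine through Log(-z) = Log z - i \<pi>.
  The point i, where the formula for B' is not available, is
  harmless since the quotient is continuous there.
\<close>
lemma exp_B_reflection:
  assumes "Im z > 0"
  shows "exp (B z + B (- z)) = 1 - \<i> * z"
proof -
  define U where "U = {z. Im z > 0}"
  define g where "g = (\<lambda>z. exp (B z + B (- z)) / (1 - \<i> * z))"
  have nz: "1 - \<i> * z \<noteq> 0" if "z \<in> U" for z
    using that by (auto simp: U_def complex_eq_iff)
  have holo: "g holomorphic_on U"
    unfolding g_def using nz upper_half_plane_not_nonpos_Real
    by (auto intro!: holomorphic_intros simp: U_def)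
  have deriv: "(g has_field_derivative 0) (at z)" if z: "z \<in> U - {\<i>}" for z
  proof -
    have im: "Im z > 0" "z \<noteq> \<i>" using z by (auto simp: U_def)
    have fac: "1 + z\<^sup>2 = (z - \<i>) * (z + \<i>)" by (simp add: power2_eq_square algebra_simps)
    have zi: "z + \<i> \<noteq> 0" "z - \<i> \<noteq> 0" using im by (auto simp: complex_eq_iff)
    then have nz2: "1 + z\<^sup>2 \<noteq> 0" unfolding fac by simp
    have z0: "z \<noteq> 0" using im by auto
    define D where "D = (\<lambda>w. (w / 2 - Ln w / complex_of_real pi) / (1 + w\<^sup>2))"
    have "(B has_field_derivative D z) (at z)"
      unfolding D_def by (intro B_has_field_derivative upper_half_plane_not_nonpos_Real im nz2)
    moreover have "((\<lambda>w. B (- w)) has_field_derivative D (- z) * (- 1)) (at z)"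
    proof (rule DERIV_chain2[where f = B])
      show "(B has_field_derivative D (- z)) (at (- z))"
        unfolding D_def using nz2 by (intro B_has_field_derivative upper_half_plane_not_nonpos_Real im) simp
    qed (auto intro!: derivative_eq_intros)
    ultimately have g': "(g has_field_derivative
        ((D z - D (- z)) * (1 - \<i> * z) + \<i>) * exp (B z + B (- z)) / (1 - \<i> * z)\<^sup>2) (at z)"
      unfolding g_def using nz[of z] z
      by (auto intro!: derivative_eq_intros simp: power2_eq_square algebra_simps)
    have "D z - D (- z) = (z - \<i>) / (1 + z\<^sup>2)"
    proof -
      have "Ln (- z) = Ln z - \<i> * complex_of_real pi" using im z0 by (simp add: Ln_minus)
      then have "D z - D (- z) = ((z / 2 - Ln z / complex_of_real pi)
          - (- z / 2 - (Ln z - \<i> * complex_of_real pi) / complex_of_real pi)) / (1 + z\<^sup>2)"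
        by (simp add: D_def flip: diff_divide_distrib)
      also have "(z / 2 - Ln z / complex_of_real pi)
          - (- z / 2 - (Ln z - \<i> * complex_of_real pi) / complex_of_real pi) = z - \<i>"
        by (simp add: diff_divide_distrib)
      finally show ?thesis .
    qed
    then have "D z - D (- z) = 1 / (z + \<i>)" unfolding fac using zi by simp
    moreover have "1 - \<i> * z = - \<i> * (z + \<i>)" by (simp add: algebra_simps)
    ultimately have "(D z - D (- z)) * (1 - \<i> * z) + \<i> = 0"
      using zi by simp
    with g' show ?thesis by simp
  qed
  \<comment> \<open>The exceptional set {i} is where the formula for the derivative of B degenerates.\<close>
  obtain c where c: "\<And>z. z \<in> U \<Longrightarrow> g z = c"
  proof (rule DERIV_zero_connected_constant[of U "{\<i>}" g])
    show "connected U" "open U"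
      unfolding U_def by (simp_all add: convex_connected convex_halfspace_Im_gt open_halfspace_Im_gt)
  qed (use deriv holomorphic_on_imp_continuous_on[OF holo] in auto)
  have "eventually (\<lambda>y. g (\<i> * complex_of_real y) = c) at_top"
    using eventually_gt_at_top[of "0::real"] by eventually_elim (auto intro!: c simp: U_def)
  moreover have "((\<lambda>y. g (\<i> * complex_of_real y)) \<longlongrightarrow> 1) at_top"
    using tendsto_exp_B_imaginary_axis by (simp add: g_def)
  ultimately have "((\<lambda>y::real. c) \<longlongrightarrow> 1) at_top"
    by (rule Lim_transform_eventually[rotated])
  then have "c = 1" by (simp add: tendsto_const_iff)
  with c[of z] nz[of z] assms show ?thesis by (simp add: U_def g_def)
qed

section \<open>The values at i and -i\<close>

lemma integral_arccot_cauchy_kernel: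
  "(LBINT s:{0<..}. (pi / 2 - arctan s) / (1 + s\<^sup>2)) = pi\<^sup>2 / 8"
proof -
  define F where "F = (\<lambda>s. pi / 2 * arctan s - (arctan s)\<^sup>2 / 2)"
  have lim_arctan: "(arctan \<longlongrightarrow> 0) (at_right 0)" "(arctan \<longlongrightarrow> pi / 2) at_top"
    by real_asymp+
  have "(F \<longlongrightarrow> pi / 2 * 0 - 0\<^sup>2 / 2) (at_right 0)" "(F \<longlongrightarrow> pi / 2 * (pi / 2) - (pi / 2)\<^sup>2 / 2) at_top"
    unfolding F_def by (intro tendsto_intros lim_arctan; simp)+
  then have lim: "((F \<circ> real_of_ereal) \<longlongrightarrow> 0) (at_right 0)"
    "((F \<circ> real_of_ereal) \<longlongrightarrow> pi\<^sup>2 / 8) (at_left \<infinity>)"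
    unfolding zero_ereal_def ereal_tendsto_simps by (simp_all add: power2_eq_square)
  have "(LBINT s=0..\<infinity>. (pi / 2 - arctan s) / (1 + s\<^sup>2)) = pi\<^sup>2 / 8 - 0"
  proof (rule interval_integral_FTC_nonneg(2)[OF _ _ _ _ lim])
    show "(F has_real_derivative (pi / 2 - arctan s) / (1 + s\<^sup>2)) (at s)" for s
      unfolding F_def by (auto intro!: derivative_eq_intros simp: field_simps add_nonneg_eq_0_iff)
    show "isCont (\<lambda>s. (pi / 2 - arctan s) / (1 + s\<^sup>2)) s" for s
      by (auto intro!: continuous_intros simp: add_nonneg_eq_0_iff)
    show "AE s in lborel. 0 < ereal s \<longrightarrow> ereal s < \<infinity> \<longrightarrow> 0 \<le> (pi / 2 - arctan s) / (1 + s\<^sup>2)"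
      using arctan_ubound by (intro AE_I2) (auto intro!: divide_nonneg_nonneg simp: less_imp_le)
  qed simp
  then show ?thesis by (simp add: interval_lebesgue_integral_0_infty)
qed

text \<open>
  The argument of s + i is \<pi>/2 - arctan s, and its product with 1 / (1 + s^2) has a primitive
  that is quadratic in arctan s.
\<close>
lemma Im_B_ii: "Im (B \<i>) = pi / 8"
proof -
  have slit: "\<i> \<notin> \<real>\<^sub>\<le>\<^sub>0" by (simp add: complex_nonpos_Reals_iff)
  have int: "integrable lborel (\<lambda>s. indicator {0<..} s *\<^sub>R
      (Ln (\<i> + complex_of_real s) / complex_of_real (1 + s\<^sup>2)))"
    using B_integrable[OF slit] unfolding set_integrable_def .
  have *: "Im (indicator {0<..} s *\<^sub>R (Ln (\<i> + complex_of_real s) / complex_of_real (1 + s\<^sup>2)))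
      = indicator {0<..} s *\<^sub>R ((pi / 2 - arctan s) / (1 + s\<^sup>2))" for s
  proof (cases "s > 0")
    case True
    then have "\<i> + complex_of_real s \<noteq> 0" by (auto simp: complex_eq_iff)
    then have "Im (Ln (\<i> + complex_of_real s)) = pi / 2 - arctan s"
      using True arctan_inverse[of s] by (simp add: Im_Ln_eq inverse_eq_divide)
    then show ?thesis using True by (simp add: Im_divide_of_real del: of_real_add)
  qed simp
  have "Im (B \<i>) = 1 / pi * (LBINT s:{0<..}. (pi / 2 - arctan s) / (1 + s\<^sup>2))"
    unfolding B_eq set_lebesgue_integral_def *[symmetric] integral_Im[OF int]
    by (simp del: of_real_add)
  then show ?thesis unfolding integral_arccot_cauchy_kernel by (simp add: power2_eq_square)
qed

text \<open>
  The reflection formula at i, where B(-i) is the conjugate of B(i), gives the modulus.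
\<close>
lemma exp_B_ii: "exp (B \<i>) = sqrt 2 * cis (pi / 8)" and exp_B_minus_ii: "exp (B (- \<i>)) = sqrt 2 * cis (- pi / 8)"
proof -
  have slit: "\<i> \<notin> \<real>\<^sub>\<le>\<^sub>0" by (simp add: complex_nonpos_Reals_iff)
  have cnj: "B (- \<i>) = cnj (B \<i>)" using B_cnj[OF slit] by simp
  then have "B \<i> + B (- \<i>) = complex_of_real (2 * Re (B \<i>))" by (simp add: complex_add_cnj)
  then have "exp (complex_of_real (2 * Re (B \<i>))) = complex_of_real 2"
    using exp_B_reflection[of \<i>] by simp
  then have "exp (2 * Re (B \<i>)) = 2" unfolding exp_of_real of_real_eq_iff .
  then have "(exp (Re (B \<i>)))\<^sup>2 = 2" by (simp add: exp_double)
  then have re: "exp (Re (B \<i>)) = sqrt 2" by (metis exp_ge_zero real_sqrt_unique)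
  show "exp (B \<i>) = sqrt 2 * cis (pi / 8)" "exp (B (- \<i>)) = sqrt 2 * cis (- pi / 8)"
    unfolding cnj exp_eq_polar by (simp_all add: re Im_B_ii)
qed

section \<open>The density on the cut\<close>

text \<open>
  Up to a constant factor this is the jump of e^B(w) / (1 + w^2) across the cut at w = -t; it
  is also the density of the Laplace integral that defines r.
\<close>
definition jump_density :: "real \<Rightarrow> real" where
  "jump_density t = t / (1 + t\<^sup>2) * exp (- log_potential t)"

lemma exp_minus_B_of_real:
  assumes "t > 0"
  shows "exp (- B (complex_of_real t)) = complex_of_real (exp (- log_potential t))"
  using assms by (simp only: B_of_real exp_of_real flip: of_real_minus)

lemma continuous_on_jump_density: "continuous_on {0<..} jump_density"
proof -
  have "B holomorphic_on (- \<real>\<^sub>\<le>\<^sub>0)"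
    using B_holomorphic[of "\<lambda>w. w" "- \<real>\<^sub>\<le>\<^sub>0"] by simp
  then have "continuous_on (- \<real>\<^sub>\<le>\<^sub>0) B" by (rule holomorphic_on_imp_continuous_on)
  moreover have "complex_of_real ` {0<..} \<subseteq> - \<real>\<^sub>\<le>\<^sub>0" by (auto simp: complex_nonpos_Reals_iff)
  moreover have "continuous_on {0<..} complex_of_real" by (intro continuous_intros)
  ultimately have "continuous_on {0<..} (\<lambda>t. B (complex_of_real t))"
    by (metis continuous_on_compose2)
  then have "continuous_on {0<..} (\<lambda>t. Re (B (complex_of_real t)))"
    by (rule continuous_on_Re)
  then have "continuous_on {0<..} log_potential"
    by (rule continuous_on_eq) (simp add: B_of_real)
  then show ?thesis
    unfolding jump_density_def by (auto intro!: continuous_intros simp: add_nonneg_eq_0_iff)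
qed

lemma jump_density_nonneg: "t > 0 \<Longrightarrow> jump_density t \<ge> 0"
  by (simp add: jump_density_def)

lemma set_integrable_jump_density: "set_integrable lborel {0<..} jump_density"
proof (rule set_integrable_half_line_mono[OF _ continuous_on_jump_density])
  show "set_integrable lborel {0<..} (\<lambda>s::real. 2 * (1 / ((1 + s) * sqrt (1 + s))))"
    by (intro set_integrable_mult_right set_integrable_minus_three_halves)
  fix t :: real assume t: "t > 0"
  have "exp (- log_potential t) \<le> 1 / sqrt t"
    using norm_exp_minus_B_le[of "complex_of_real t"] t by (simp add: exp_minus_B_of_real)
  then have "jump_density t \<le> t / (1 + t\<^sup>2) * (1 / sqrt t)"
    unfolding jump_density_def using t by (intro mult_left_mono) auto
  also have "\<dots> = sqrt t / (1 + t\<^sup>2)"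
    using t real_div_sqrt[of t]
    by (metis divide_divide_eq_left' less_imp_le mult.right_neutral times_divide_eq_right
        divide_divide_eq_left mult.commute)
  also have "\<dots> \<le> sqrt (1 + t) / (1 + t\<^sup>2)" by (intro divide_right_mono) auto
  also have "\<dots> \<le> 2 * (1 / ((1 + t) * sqrt (1 + t)))" by (rule inverse_one_plus_square_le[OF t])
  finally show "norm (jump_density t) \<le> 2 * (1 / ((1 + t) * sqrt (1 + t)))"
    using jump_density_nonneg[OF t] by simp
qed

lemma of_real_add_neq_0: "Re z > 0 \<Longrightarrow> t \<ge> 0 \<Longrightarrow> complex_of_real t + z \<noteq> 0"
  by (auto simp: complex_eq_iff)

lemma set_integrable_jump_density_stieltjes:
  assumes "Re z > 0"
  shows "set_integrable lborel {0<..} (\<lambda>t. complex_of_real (jump_density t) / (complex_of_real t + z))"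
proof (rule set_integrable_half_line_mono)
  show "set_integrable lborel {0<..} (\<lambda>t. (1 / Re z) * jump_density t)"
    by (intro set_integrable_mult_right set_integrable_jump_density)
  show "continuous_on {0<..} (\<lambda>t. complex_of_real (jump_density t) / (complex_of_real t + z))"
    using of_real_add_neq_0[OF assms]
    by (intro continuous_intros continuous_on_jump_density) auto
  fix t :: real assume t: "t > 0"
  have "Re z \<le> norm (complex_of_real t + z)"
    using complex_Re_le_cmod[of "complex_of_real t + z"] t by simp
  then have "jump_density t / norm (complex_of_real t + z) \<le> jump_density t / Re z"
    using assms jump_density_nonneg[OF t] by (intro divide_left_mono mult_pos_pos) auto
  then show "norm (complex_of_real (jump_density t) / (complex_of_real t + z)) \<le> (1 / Re z) * jump_density t"
    using jump_density_nonneg[OF t] by (simp add: norm_divide)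
qed

section \<open>Continuation across the cut in logarithmic coordinates\<close>

lemma exp_not_nonpos_Real:
  assumes "\<bar>Im u\<bar> < pi"
  shows "exp u \<notin> \<real>\<^sub>\<le>\<^sub>0"
proof
  assume "exp u \<in> \<real>\<^sub>\<le>\<^sub>0"
  then have "Im (Ln (exp u)) = pi"
    using exp_not_eq_zero[of u]
    by (subst Im_Ln_eq_pi) (auto simp: complex_nonpos_Reals_iff order_less_le complex_eq_iff simp del: exp_not_eq_zero)
  moreover have "Ln (exp u) = u" using assms by (intro Ln_exp) auto
  ultimately show False using assms by simp
qed

lemma minus_exp_eq: "- exp u = exp (u - \<i> * pi)" "- exp u = exp (u + \<i> * pi)"
  by (simp_all add: exp_diff exp_add)

lemma minus_exp_not_nonpos_Real:
  assumes "0 < \<bar>Im u\<bar>" "\<bar>Im u\<bar> < 2 * pi"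
  shows "- exp u \<notin> \<real>\<^sub>\<le>\<^sub>0"
proof (cases "Im u > 0")
  case True
  then show ?thesis unfolding minus_exp_eq(1) using assms by (intro exp_not_nonpos_Real) auto
next
  case False
  then show ?thesis unfolding minus_exp_eq(2) using assms by (intro exp_not_nonpos_Real) auto
qed

text \<open>
  The function e^B(w) / (1 + w^2) in the coordinate w = e^u, continued holomorphically
  beyond the lines Im u = \<plusminus>\<pi>, which are the two banks of the cut. Beyond a bank
  the principal branch in B would jump, so the reflected expression is used from there on.
\<close>
definition strip_continuation :: "complex \<Rightarrow> complex" where
  "strip_continuation u =
    (if Im u \<ge> pi then exp (- B (- exp u)) / (1 + \<i> * exp u)
     else if Im u \<le> - pi then exp (- B (- exp u)) / (1 - \<i> * exp u)
     else exp (B (exp u)) / (1 + (exp u)\<^sup>2))"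

text \<open>
  The reflection formula with the common factor 1 - i w of 1 + w^2 cancelled. Both parts are
  valid even at the poles, where the two sides have the value 0 of a division by 0.
\<close>
lemma exp_B_div_reflect:
  assumes "Im w > 0"
  shows "exp (B w) / (1 + w\<^sup>2) = exp (- B (- w)) / (1 + \<i> * w)"
    and "exp (B (- w)) / (1 + w\<^sup>2) = exp (- B w) / (1 - \<i> * (- w))"
proof -
  have nz: "1 - \<i> * w \<noteq> 0" using assms by (auto simp: complex_eq_iff)
  have fac: "1 + w\<^sup>2 = (1 - \<i> * w) * (1 + \<i> * w)"
    by (simp add: power2_eq_square algebra_simps)
  have refl: "exp (B w) * exp (B (- w)) = 1 - \<i> * w"
    using exp_B_reflection[OF assms] by (simp add: exp_add)
  have "exp (B w) = (1 - \<i> * w) * exp (- B (- w))" "exp (B (- w)) = (1 - \<i> * w) * exp (- B w)"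
    unfolding refl[symmetric] by (simp_all add: exp_minus field_simps)
  then show "exp (B w) / (1 + w\<^sup>2) = exp (- B (- w)) / (1 + \<i> * w)"
    "exp (B (- w)) / (1 + w\<^sup>2) = exp (- B w) / (1 - \<i> * (- w))"
    unfolding fac using nz by simp_all
qed

lemma Im_exp_pos: "0 < Im u \<Longrightarrow> Im u < pi \<Longrightarrow> Im (exp u) > 0"
  by (simp add: Im_exp sin_gt_zero)

lemma strip_continuation_middle:
  "\<bar>Im u\<bar> < pi \<Longrightarrow> strip_continuation u = exp (B (exp u)) / (1 + (exp u)\<^sup>2)"
  by (auto simp: strip_continuation_def)

lemma strip_continuation_upper:
  assumes "0 < Im u"
  shows "strip_continuation u = exp (- B (- exp u)) / (1 + \<i> * exp u)"
  using assms exp_B_div_reflect(1)[of "exp u"] Im_exp_pos[of u]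
  by (auto simp: strip_continuation_def)

lemma strip_continuation_lower:
  assumes "Im u < 0"
  shows "strip_continuation u = exp (- B (- exp u)) / (1 - \<i> * exp u)"
proof (cases "Im u > - pi")
  case True
  have "Im (- exp u) > 0"
    using assms True sin_gt_zero[of "- Im u"] by (simp add: Im_exp mult_pos_neg)
  from exp_B_div_reflect(2)[OF this] show ?thesis
    using assms True by (auto simp: strip_continuation_def)
next
  case False
  then have "\<not> Im u \<ge> pi" "Im u \<le> - pi" using assms pi_gt_zero by linarith+
  then show ?thesis by (simp add: strip_continuation_def)
qed

text \<open>
  The arguments differ by less than a full period of exp.
\<close>
lemma exp_inj_strip:
  assumes "exp u = exp v" "\<bar>Im u\<bar> < 3 * pi / 2" "\<bar>Im v\<bar> \<le> pi / 2"
  shows "u = v"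
proof (rule exp_complex_eqI[OF _ assms(1)])
  show "\<bar>Im u - Im v\<bar> < 2 * pi" using assms(2,3) by linarith
qed

lemma exp_half_pi_ii: "exp (\<i> * (pi / 2)) = \<i>" "exp (- (\<i> * (pi / 2))) = - \<i>"
  by (simp_all add: exp_eq_polar)

text \<open>
  For Re z > 0 these are the preimages of z, i and -i under exp in the strip |Im u| < 3\<pi>/2. The
  arguments of the three points have modulus at most \<pi>/2, and 3\<pi>/2 = 2\<pi> - \<pi>/2, so each point
  has only one preimage there.
\<close>
definition strip_poles :: "complex \<Rightarrow> complex set" where
  "strip_poles z = {Ln z, \<i> * (pi / 2), - (\<i> * (pi / 2))}"

text \<open>
  The Cauchy kernel 1/(w - z) and dw = e^u du, pulled back to the strip.
\<close>
definition strip_integrand :: "complex \<Rightarrow> complex \<Rightarrow> complex" where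
  "strip_integrand z u = strip_continuation u * exp u / (exp u - z)"

lemma exp_neq_off_strip_poles:
  assumes "Re z > 0" "\<bar>Im u\<bar> < 3 * pi / 2" "u \<notin> strip_poles z"
  shows "exp u \<noteq> z" "exp u \<noteq> \<i>" "exp u \<noteq> - \<i>"
proof -
  have z: "z \<noteq> 0" using assms(1) by auto
  then have "\<bar>Im (Ln z)\<bar> < pi / 2" using Re_Ln_pos_lt[of z] assms(1) by simp
  then show "exp u \<noteq> z"
    using exp_inj_strip[of u "Ln z"] assms z by (auto simp: strip_poles_def)
  show "exp u \<noteq> \<i>" "exp u \<noteq> - \<i>"
    using exp_inj_strip[of u "\<i> * (pi / 2)"] exp_inj_strip[of u "- (\<i> * (pi / 2))"] assms
    unfolding exp_half_pi_ii by (auto simp: strip_poles_def)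
qed

lemma one_plus_ii_times_eq_0_iff: "1 + \<i> * w = 0 \<longleftrightarrow> w = \<i>" "1 - \<i> * w = 0 \<longleftrightarrow> w = - \<i>"
  by (auto simp: complex_eq_iff)

lemma one_plus_square_eq_0_iff: "1 + w\<^sup>2 = 0 \<longleftrightarrow> w = \<i> \<or> w = - \<i>" for w :: complex
proof -
  have "1 + w\<^sup>2 = (1 + \<i> * w) * (1 - \<i> * w)" by (simp add: power2_eq_square algebra_simps)
  then show ?thesis using one_plus_ii_times_eq_0_iff[of w] by (metis mult_eq_0_iff)
qed

lemma open_Im_strip: "open {u. a < Im u \<and> Im u < b}"
  by (intro open_Collect_conj open_Collect_less continuous_intros)

text \<open>
  The strip is covered by three overlapping open strips, and on each of them one of the
  expressions for strip_continuation is valid.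
\<close>
lemma strip_integrand_holomorphic:
  assumes "Re z > 0"
  shows "strip_integrand z holomorphic_on {u. - (3 * pi / 2) < Im u \<and> Im u < 3 * pi / 2} - strip_poles z"
proof -
  have fin: "closed (strip_poles z)" by (simp add: strip_poles_def finite_imp_closed)
  define M where "M = {u. - pi < Im u \<and> Im u < pi} - strip_poles z"
  define U where "U = {u. 0 < Im u \<and> Im u < 3 * pi / 2} - strip_poles z"
  define L where "L = {u. - (3 * pi / 2) < Im u \<and> Im u < 0} - strip_poles z"
  have opens: "open M" "open U" "open L"
    unfolding M_def U_def L_def by (intro open_Diff open_Im_strip fin)+
  have neq: "exp u \<noteq> z" "exp u \<noteq> \<i>" "exp u \<noteq> - \<i>" if "u \<in> M \<union> U \<union> L" for u
  proof -
    have "\<bar>Im u\<bar> < 3 * pi / 2" "u \<notin> strip_poles z"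
      using that pi_gt_zero unfolding M_def U_def L_def by auto
    then show "exp u \<noteq> z" "exp u \<noteq> \<i>" "exp u \<noteq> - \<i>" by (rule exp_neq_off_strip_poles[OF assms])+
  qed
  have "(\<lambda>u. exp (B (exp u)) / (1 + (exp u)\<^sup>2) * exp u / (exp u - z)) holomorphic_on M"
    using neq exp_not_nonpos_Real by (auto intro!: holomorphic_intros simp: one_plus_square_eq_0_iff M_def)
  then have M: "strip_integrand z holomorphic_on M"
    by (rule holomorphic_transform) (auto simp: strip_integrand_def strip_continuation_middle M_def)
  have "(\<lambda>u. exp (- B (- exp u)) / (1 + \<i> * exp u) * exp u / (exp u - z)) holomorphic_on U"
    using neq minus_exp_not_nonpos_Real
    by (auto intro!: holomorphic_intros simp: one_plus_ii_times_eq_0_iff U_def)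
  then have U: "strip_integrand z holomorphic_on U"
    by (rule holomorphic_transform) (auto simp: strip_integrand_def strip_continuation_upper U_def)
  have "(\<lambda>u. exp (- B (- exp u)) / (1 - \<i> * exp u) * exp u / (exp u - z)) holomorphic_on L"
  proof -
    have "1 - \<i> * exp u \<noteq> 0" "exp u - z \<noteq> 0" "- exp u \<notin> \<real>\<^sub>\<le>\<^sub>0" if "u \<in> L" for u
    proof -
      show "1 - \<i> * exp u \<noteq> 0" "exp u - z \<noteq> 0"
        unfolding one_plus_ii_times_eq_0_iff using neq[of u] that by auto
      show "- exp u \<notin> \<real>\<^sub>\<le>\<^sub>0"
        using that pi_gt_zero by (intro minus_exp_not_nonpos_Real) (auto simp: L_def)
    qed
    then show ?thesis by (intro holomorphic_intros) blast+
  qed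
  then have L: "strip_integrand z holomorphic_on L"
    by (rule holomorphic_transform) (auto simp: strip_integrand_def strip_continuation_lower L_def)
  have "strip_integrand z holomorphic_on (M \<union> U) \<union> L"
    by (intro holomorphic_on_Un M U L opens open_Un)
  then show ?thesis
    by (rule holomorphic_on_subset) (auto simp: M_def U_def L_def)
qed

section \<open>Residues\<close>

text \<open>
  On the strip |Im u| < \<pi> the exponential is injective, so the factor e^u - a has only the
  zero p there, and it is simple with derivative a.
\<close>
lemma residue_simple_root_exp:
  fixes E :: "complex \<Rightarrow> complex"
  assumes V: "V = {u. - pi < Im u \<and> Im u < pi}"
    and E: "E holomorphic_on V" and p: "p \<in> V" "exp p = a"
    and ne: "b \<noteq> a" "c \<noteq> a"
    and f: "\<And>u. u \<in> V \<Longrightarrow> f u = E u / ((exp u - a) * (exp u - b) * (exp u - c))"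
  shows "residue f p = E p / (a * (a - b) * (a - c))"
proof -
  define S where "S = V \<inter> {u. exp u \<noteq> b} \<inter> {u. exp u \<noteq> c}"
  have "open S"
    unfolding S_def V by (intro open_Int open_Im_strip open_Collect_neq continuous_intros)
  have inj: "u = p" if "u \<in> V" "exp u = a" for u
  proof (rule exp_complex_eqI)
    have "- pi < Im u" "Im u < pi" "- pi < Im p" "Im p < pi" using that(1) p(1) by (simp_all add: V)
    then show "\<bar>Im u - Im p\<bar> < 2 * pi" by linarith
  qed (simp add: that p)
  show ?thesis
  proof (rule residue_simple'[OF \<open>open S\<close>])
    show "p \<in> S" using p ne by (auto simp: S_def)
    have "(\<lambda>u. E u / ((exp u - a) * (exp u - b) * (exp u - c))) holomorphic_on S - {p}"
      using inj by (auto intro!: holomorphic_intros holomorphic_on_subset[OF E] simp: S_def)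
    then show "f holomorphic_on S - {p}"
      by (rule holomorphic_transform) (auto simp: f S_def)
    have "(exp has_field_derivative a) (at p)" using p(2) by (auto intro!: derivative_eq_intros)
    then have lim1: "((\<lambda>u. (exp u - a) / (u - p)) \<longlongrightarrow> a) (at p)"
      by (simp add: has_field_derivative_iff p(2))
    have lim2: "((\<lambda>u. E u / ((exp u - b) * (exp u - c))) \<longlongrightarrow> E p / ((a - b) * (a - c))) (at p)"
    proof -
      have "isCont E p"
        using holomorphic_on_imp_continuous_on[OF E] p(1) unfolding V
        by (simp add: continuous_on_eq_continuous_at open_Im_strip)
      then have "isCont (\<lambda>u. E u / ((exp u - b) * (exp u - c))) p"
        using p(2) ne by (auto intro!: continuous_intros)
      then show ?thesis by (simp add: isCont_def p(2))
    qed
    have "a \<noteq> 0" using p(2) by auto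
    from tendsto_divide[OF lim2 lim1 this] have "((\<lambda>u. E u / ((exp u - b) * (exp u - c)) / ((exp u - a) / (u - p)))
        \<longlongrightarrow> E p / ((a - b) * (a - c)) / a) (at p)" .
    moreover have "eventually (\<lambda>u. E u / ((exp u - b) * (exp u - c)) / ((exp u - a) / (u - p))
        = f u * (u - p)) (at p)"
      using eventually_at_in_open[OF \<open>open S\<close> \<open>p \<in> S\<close>]
      by eventually_elim (auto simp: f S_def mult_ac)
    ultimately have "((\<lambda>u. f u * (u - p)) \<longlongrightarrow> E p / ((a - b) * (a - c)) / a) (at p)"
      by (rule Lim_transform_eventually)
    then show "((\<lambda>u. f u * (u - p)) \<longlongrightarrow> E p / (a * (a - b) * (a - c))) (at p)"
      by (simp add: mult_ac)
  qed
qed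

lemma sum_residues_strip_integrand:
  assumes z: "Re z > 0"
  shows "(\<Sum>p\<in>strip_poles z. residue (strip_integrand z) p)
    = exp (B z) / (1 + z\<^sup>2)
      - complex_of_real (sqrt 2) * (complex_of_real (cos (pi / 8)) + z * complex_of_real (sin (pi / 8))) / (1 + z\<^sup>2)"
proof -
  define V where "V = {u. - pi < Im u \<and> Im u < pi}"
  define E where "E = (\<lambda>u. exp (B (exp u)) * exp u)"
  have E: "E holomorphic_on V"
    unfolding E_def V_def using exp_not_nonpos_Real by (auto intro!: holomorphic_intros)
  have f: "strip_integrand z u = E u / ((exp u - z) * (exp u - \<i>) * (exp u - (- \<i>)))" if "u \<in> V" for u
  proof -
    have "(exp u - z) * (exp u - \<i>) * (exp u - (- \<i>)) = (1 + (exp u)\<^sup>2) * (exp u - z)"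
      by (simp add: power2_eq_square algebra_simps)
    moreover have "strip_continuation u = exp (B (exp u)) / (1 + (exp u)\<^sup>2)"
      using that by (intro strip_continuation_middle) (auto simp: V_def)
    ultimately show ?thesis
      by (simp only: strip_integrand_def E_def times_divide_eq_left divide_divide_eq_left)
  qed
  have z0: "z \<noteq> 0" "z \<noteq> \<i>" "z \<noteq> - \<i>" using z by auto
  have Ln: "\<bar>Im (Ln z)\<bar> < pi / 2" using Re_Ln_pos_lt[of z] z z0 by simp
  have 1: "residue (strip_integrand z) (Ln z) = E (Ln z) / (z * (z - \<i>) * (z - (- \<i>)))"
    by (rule residue_simple_root_exp[OF V_def E]) (use Ln z0 f in \<open>auto simp: V_def\<close>)
  have 2: "residue (strip_integrand z) (\<i> * (pi / 2)) = E (\<i> * (pi / 2)) / (\<i> * (\<i> - z) * (\<i> - (- \<i>)))"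
    by (rule residue_simple_root_exp[OF V_def E _ exp_half_pi_ii(1)])
      (use z0 f pi_gt_zero in \<open>auto simp: V_def mult_ac\<close>)
  have "Im (- (\<i> * (pi / 2))) = - (pi / 2)" by simp
  then have p3: "- (\<i> * (pi / 2)) \<in> V"
    unfolding V_def mem_Collect_eq using pi_gt_zero by linarith
  have 3: "residue (strip_integrand z) (- (\<i> * (pi / 2))) = E (- (\<i> * (pi / 2))) / (- \<i> * (- \<i> - z) * (- \<i> - \<i>))"
    by (rule residue_simple_root_exp[OF V_def E p3 exp_half_pi_ii(2)])
      (use z0 f in \<open>auto simp: V_def mult_ac\<close>)
  have fac: "(z - \<i>) * (z - (- \<i>)) = 1 + z\<^sup>2" by (simp add: power2_eq_square algebra_simps)
  have r1: "residue (strip_integrand z) (Ln z) = exp (B z) / (1 + z\<^sup>2)"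
    unfolding 1 mult.assoc fac using z0 by (simp add: E_def)
  define q where "q = complex_of_real (sqrt 2)"
  have r23: "residue (strip_integrand z) (\<i> * (pi / 2)) + residue (strip_integrand z) (- (\<i> * (pi / 2)))
    = - q * (complex_of_real (cos (pi / 8)) + z * complex_of_real (sin (pi / 8))) / (1 + z\<^sup>2)"
  proof -
    let ?c = "complex_of_real (cos (pi / 8))" and ?s = "complex_of_real (sin (pi / 8))"
    have cis: "cis (pi / 8) = ?c + \<i> * ?s" "cis (- pi / 8) = ?c - \<i> * ?s"
      by (simp_all add: complex_eq_iff)
    have "residue (strip_integrand z) (\<i> * (pi / 2)) = q * (?c + \<i> * ?s) / (2 * \<i> * (\<i> - z))"
    proof -
      have "\<i> * (\<i> - z) * (\<i> - (- \<i>)) = (2 * \<i> * (\<i> - z)) * \<i>" by (simp add: algebra_simps)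
      then show ?thesis
        unfolding 2 E_def exp_half_pi_ii exp_B_ii cis q_def by (simp only:) simp
    qed
    also have "\<dots> = q * (?c + \<i> * ?s) * (\<i> + z) / (- 2 * \<i> * (1 + z\<^sup>2))"
    proof -
      have "- 2 * \<i> * (1 + z\<^sup>2) = (2 * \<i> * (\<i> - z)) * (\<i> + z)"
        by (simp add: power2_eq_square algebra_simps)
      moreover have "\<i> + z \<noteq> 0" using z by (auto simp: complex_eq_iff)
      ultimately show ?thesis by (simp only: mult_divide_mult_cancel_right not_False_eq_True)
    qed
    finally have a: "residue (strip_integrand z) (\<i> * (pi / 2))
      = q * (?c + \<i> * ?s) * (\<i> + z) / (- 2 * \<i> * (1 + z\<^sup>2))" .
    have "residue (strip_integrand z) (- (\<i> * (pi / 2))) = q * (?c - \<i> * ?s) / (2 * \<i> * (\<i> + z))"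
    proof -
      have "- \<i> * (- \<i> - z) * (- \<i> - \<i>) = (2 * \<i> * (\<i> + z)) * (- \<i>)" by (simp add: algebra_simps)
      then show ?thesis
        unfolding 3 E_def exp_half_pi_ii exp_B_minus_ii cis q_def by (simp only:) simp
    qed
    also have "\<dots> = q * (?c - \<i> * ?s) * (\<i> - z) / (- 2 * \<i> * (1 + z\<^sup>2))"
    proof -
      have "- 2 * \<i> * (1 + z\<^sup>2) = (2 * \<i> * (\<i> + z)) * (\<i> - z)"
        by (simp add: power2_eq_square algebra_simps)
      moreover have "\<i> - z \<noteq> 0" using z by (auto simp: complex_eq_iff)
      ultimately show ?thesis by (simp only: mult_divide_mult_cancel_right not_False_eq_True)
    qed
    finally have b: "residue (strip_integrand z) (- (\<i> * (pi / 2)))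
      = q * (?c - \<i> * ?s) * (\<i> - z) / (- 2 * \<i> * (1 + z\<^sup>2))" .
    have e: "(?c + \<i> * ?s) * (\<i> + z) + (?c - \<i> * ?s) * (\<i> - z) = 2 * \<i> * (?c + z * ?s)"
      by (simp add: algebra_simps)
    have "residue (strip_integrand z) (\<i> * (pi / 2)) + residue (strip_integrand z) (- (\<i> * (pi / 2)))
      = q * (2 * \<i> * (?c + z * ?s)) / (- 2 * \<i> * (1 + z\<^sup>2))"
      unfolding a b e[symmetric] by (simp only: mult.assoc flip: add_divide_distrib distrib_left)
    then show ?thesis by simp
  qed
  have distinct: "Ln z \<noteq> \<i> * (pi / 2)" "Ln z \<noteq> - (\<i> * (pi / 2))" "\<i> * (pi / 2) \<noteq> - (\<i> * (pi / 2))"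
  proof -
    have im: "Im (\<i> * (pi / 2)) = pi / 2" "Im (- (\<i> * (pi / 2))) = - (pi / 2)" by simp_all
    then have "Im (Ln z) \<noteq> Im (\<i> * (pi / 2))" "Im (Ln z) \<noteq> Im (- (\<i> * (pi / 2)))"
      "Im (\<i> * (pi / 2)) \<noteq> Im (- (\<i> * (pi / 2)))"
      using Ln pi_gt_zero unfolding im by linarith+
    then show "Ln z \<noteq> \<i> * (pi / 2)" "Ln z \<noteq> - (\<i> * (pi / 2))" "\<i> * (pi / 2) \<noteq> - (\<i> * (pi / 2))"
      by metis+
  qed
  have "(\<Sum>p\<in>strip_poles z. residue (strip_integrand z) p) = residue (strip_integrand z) (Ln z) +
    (residue (strip_integrand z) (\<i> * (pi / 2)) + residue (strip_integrand z) (- (\<i> * (pi / 2))))"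
    unfolding strip_poles_def using distinct by simp
  then show ?thesis unfolding r1 r23 q_def by simp
qed

section \<open>The contour integral\<close>

text \<open>
  The two summands correspond to the right and left half-planes for w = e^u. For Re w \<ge> 0
  the direct expression is bounded by the growth of e^B; for Re w < 0 the reflected one has its argument -w
  in the right half-plane, where |e^(-B)| is at most t^(-1/2).
\<close>
lemma norm_strip_continuation_le:
  obtains C where "C > 0"
    "\<And>u t. \<bar>Im u\<bar> \<le> pi \<Longrightarrow> t = exp (Re u) \<Longrightarrow> t \<noteq> 1 \<Longrightarrow>
      norm (strip_continuation u) \<le> C * sqrt (1 + t) / \<bar>1 - t\<^sup>2\<bar> + 1 / (sqrt t * \<bar>1 - t\<bar>)"
proof -
  obtain C where C: "C > 0"
    "\<And>z. Re z \<ge> 0 \<Longrightarrow> z \<noteq> 0 \<Longrightarrow> norm (exp (B z)) \<le> C * sqrt (1 + norm z)"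
    using norm_exp_B_le by blast
  have "norm (strip_continuation u) \<le> C * sqrt (1 + t) / \<bar>1 - t\<^sup>2\<bar> + 1 / (sqrt t * \<bar>1 - t\<bar>)"
    if u: "\<bar>Im u\<bar> \<le> pi" and t: "t = exp (Re u)" and t1: "t \<noteq> 1" for u t
  proof -
    have tpos: "t > 0" and nt: "norm (exp u) = t" using t by simp_all
    have t2: "t\<^sup>2 \<noteq> 1" using tpos t1 by (simp add: power2_eq_1_iff)
    have first: "0 \<le> C * sqrt (1 + t) / \<bar>1 - t\<^sup>2\<bar>" and second: "0 \<le> 1 / (sqrt t * \<bar>1 - t\<bar>)"
      using C(1) tpos by simp_all
    show ?thesis
    proof (cases "Re (exp u) \<ge> 0")
      case True
      \<comment> \<open>The lines Im u = \<plusminus>\<pi> lie over the negative half-line.\<close>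
      have "\<bar>Im u\<bar> \<noteq> pi"
      proof
        assume "\<bar>Im u\<bar> = pi"
        then have "Im u = pi \<or> Im u = - pi" by linarith
        then have "cos (Im u) = - 1" by auto
        then show False using True by (simp add: Re_exp)
      qed
      then have "strip_continuation u = exp (B (exp u)) / (1 + (exp u)\<^sup>2)"
        using u by (intro strip_continuation_middle) linarith
      moreover have "\<bar>1 - t\<^sup>2\<bar> \<le> norm (1 + (exp u)\<^sup>2)"
        using norm_triangle_ineq3[of 1 "- (exp u)\<^sup>2"] nt by (simp add: norm_power)
      ultimately have "norm (strip_continuation u) \<le> C * sqrt (1 + t) / \<bar>1 - t\<^sup>2\<bar>"
        using C(2)[OF True] nt t2 C(1) tpos by (simp only: norm_divide) (intro frac_le; simp)
      then show ?thesis using second by linarith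
    next
      case False
      then have neg: "Re (- exp u) \<ge> 0" by simp
      have G: "norm (exp (- B (- exp u))) \<le> 1 / sqrt t"
        using norm_exp_minus_B_le[OF neg] nt by simp
      have "Im u \<noteq> 0" using False by (auto simp: Re_exp)
      then obtain w where w: "norm w = t" "strip_continuation u = exp (- B (- exp u)) / (1 + w)"
      proof (cases "Im u > 0")
        case True
        then show ?thesis using strip_continuation_upper[of u] nt by (intro that[of "\<i> * exp u"]) (auto simp: norm_mult)
      next
        case False
        then show ?thesis using strip_continuation_lower[of u] nt \<open>Im u \<noteq> 0\<close>
          by (intro that[of "- (\<i> * exp u)"]) (auto simp: norm_mult)
      qed
      have "\<bar>1 - t\<bar> \<le> norm (1 + w)"
        using norm_triangle_ineq3[of 1 "- w"] w(1) by simp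
      then have "norm (strip_continuation u) \<le> (1 / sqrt t) / \<bar>1 - t\<bar>"
        unfolding w(2) norm_divide using G t1 tpos by (intro frac_le) auto
      also have "(1 / sqrt t) / \<bar>1 - t\<bar> = 1 / (sqrt t * \<bar>1 - t\<bar>)" by simp
      finally show ?thesis using first by linarith
    qed
  qed
  with C(1) that show ?thesis by blast
qed

text \<open>
  With t = e^x the bound is O(t^(-3/2)) as t tends to infinity and O(t^(1/2)) as t tends to 0,
  hence the vertical sides of the rectangle contribute nothing in the limit.
\<close>
lemma norm_strip_integrand_le:
  assumes "z \<noteq> 0"
  obtains M where "(M \<longlongrightarrow> 0) at_top" "((\<lambda>R. M (- R)) \<longlongrightarrow> 0) at_top"
    "\<And>u. exp (Re u) \<noteq> 1 \<Longrightarrow> exp (Re u) \<noteq> norm z \<Longrightarrow> \<bar>Im u\<bar> \<le> pi \<Longrightarrow>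
      norm (strip_integrand z u) \<le> M (Re u)"
proof -
  obtain C where C: "C > 0" "\<And>u t. \<bar>Im u\<bar> \<le> pi \<Longrightarrow> t = exp (Re u) \<Longrightarrow> t \<noteq> 1 \<Longrightarrow>
      norm (strip_continuation u) \<le> C * sqrt (1 + t) / \<bar>1 - t\<^sup>2\<bar> + 1 / (sqrt t * \<bar>1 - t\<bar>)"
    using norm_strip_continuation_le by blast
  define a where "a = norm z"
  have a: "a > 0" using assms by (simp add: a_def)
  \<comment> \<open>The denominators vanish only for e^x = 1 and e^x = |z|, away from both limits.\<close>
  define M where "M = (\<lambda>x. (C * sqrt (1 + exp x) / \<bar>1 - (exp x)\<^sup>2\<bar> + 1 / (sqrt (exp x) * \<bar>1 - exp x\<bar>))
      * (exp x / \<bar>exp x - a\<bar>))"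
  show ?thesis
  proof (rule that)
    show "(M \<longlongrightarrow> 0) at_top" "((\<lambda>R. M (- R)) \<longlongrightarrow> 0) at_top"
      unfolding M_def using C(1) a by real_asymp+
    fix u assume x: "exp (Re u) \<noteq> 1" "exp (Re u) \<noteq> norm z" and y: "\<bar>Im u\<bar> \<le> pi"
    let ?x = "Re u"
    have "norm (strip_continuation u)
        \<le> C * sqrt (1 + exp ?x) / \<bar>1 - (exp ?x)\<^sup>2\<bar> + 1 / (sqrt (exp ?x) * \<bar>1 - exp ?x\<bar>)"
      by (rule C(2)[OF y refl x(1)])
    moreover have "\<bar>exp ?x - a\<bar> \<le> norm (exp u - z)"
      using norm_triangle_ineq3[of "exp u" z] by (simp add: a_def)
    then have "norm (exp u) / norm (exp u - z) \<le> exp ?x / \<bar>exp ?x - a\<bar>"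
      using x by (intro frac_le) (auto simp: a_def)
    ultimately show "norm (strip_integrand z u) \<le> M ?x"
      unfolding strip_integrand_def M_def norm_divide norm_mult times_divide_eq_right[symmetric]
      using C(1) by (intro mult_mono) (auto intro!: add_nonneg_nonneg)
  qed
qed

lemma contour_integral_linepath_same_Im:
  fixes f :: "complex \<Rightarrow> complex"
  assumes "a \<le> b" "continuous_on {a..b} (\<lambda>x. f (Complex x c))"
  shows "contour_integral (linepath (Complex a c) (Complex b c)) f = integral {a..b} (\<lambda>x. f (Complex x c))"
proof -
  have "((\<lambda>t. (b - a) *\<^sub>R f (Complex (a + (b - a) * t) c)) has_integral
      integral {a + (b - a) * 0..a + (b - a) * 1} (\<lambda>x. f (Complex x c))) {0..1}"
  proof (rule has_integral_substitution)
    show "(\<lambda>t. a + (b - a) * t) ` {0..1} \<subseteq> {a..b}"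
      using assms(1) by (auto intro: mult_nonneg_nonneg) (metis add.commute diff_add_cancel
        diff_ge_0_iff_ge mult_left_le add_le_cancel_right)
  qed (use assms in \<open>auto intro!: derivative_eq_intros\<close>)
  moreover have "linepath (Complex a c) (Complex b c) t = Complex (a + (b - a) * t) c" for t
    by (simp add: linepath_def complex_eq_iff algebra_simps)
  moreover have "Complex b c - Complex a c = complex_of_real (b - a)" by (simp add: complex_eq_iff)
  ultimately have "(f has_contour_integral integral {a..b} (\<lambda>x. f (Complex x c)))
      (linepath (Complex a c) (Complex b c))"
    by (simp add: has_contour_integral_linepath scaleR_conv_of_real mult.commute del: of_real_diff)
  then show ?thesis by (rule contour_integral_unique)
qed

text \<open>
  On both lines e^u = -t with t = e^x, so both values contain e^(-B(t)) and differ
  only through 1/(1 + i t) against 1/(1 - i t).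
\<close>
lemma strip_integrand_jump:
  assumes z: "Re z > 0"
  shows "strip_integrand z (Complex x (- pi)) - strip_integrand z (Complex x pi)
    = - 2 * \<i> * (exp x *\<^sub>R (complex_of_real (jump_density (exp x)) / (complex_of_real (exp x) + z)))"
proof -
  define t where "t = exp x"
  have t: "t > 0" by (simp add: t_def)
  have e: "exp (Complex x pi) = - complex_of_real t" "exp (Complex x (- pi)) = - complex_of_real t"
    by (simp_all add: exp_eq_polar t_def exp_of_real complex_eq_iff)
  define G where "G = complex_of_real (exp (- log_potential t))"
  let ?T = "complex_of_real t"
  have np: "?T + z \<noteq> 0" using of_real_add_neq_0[OF z, of t] t by simp
  \<comment> \<open>The factor w / (w - z) at w = -t.\<close>
  have frac: "- ?T / (- ?T - z) = ?T / (?T + z)"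
    by (metis minus_diff_eq diff_minus_eq_add minus_divide_divide minus_diff_commute)
  have not_pi_le: "\<not> pi \<le> - pi" "\<not> pi \<le> 0" using pi_gt_zero by linarith+
  have top: "strip_integrand z (Complex x pi) = G / (1 - \<i> * ?T) * (?T / (?T + z))"
    unfolding strip_integrand_def strip_continuation_def e G_def exp_minus_B_of_real[OF t, symmetric]
    by (simp add: frac[symmetric])
  have bottom: "strip_integrand z (Complex x (- pi)) = G / (1 + \<i> * ?T) * (?T / (?T + z))"
    unfolding strip_integrand_def strip_continuation_def e G_def exp_minus_B_of_real[OF t, symmetric]
    using not_pi_le by (simp add: frac[symmetric])
  have nz: "1 + \<i> * ?T \<noteq> 0" "1 - \<i> * ?T \<noteq> 0" by (auto simp: complex_eq_iff)
  have "G / (1 + \<i> * ?T) - G / (1 - \<i> * ?T) = - 2 * \<i> * (?T * G) / ((1 + \<i> * ?T) * (1 - \<i> * ?T))"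
    using nz by (subst diff_frac_eq) (simp_all add: algebra_simps)
  also have "(1 + \<i> * ?T) * (1 - \<i> * ?T) = complex_of_real (1 + t\<^sup>2)"
    by (simp add: power2_eq_square algebra_simps)
  finally have jump: "G / (1 + \<i> * ?T) - G / (1 - \<i> * ?T) = - 2 * \<i> * complex_of_real (jump_density t)"
    by (simp add: jump_density_def G_def)
  have "strip_integrand z (Complex x (- pi)) - strip_integrand z (Complex x pi)
      = (G / (1 + \<i> * ?T) - G / (1 - \<i> * ?T)) * (?T / (?T + z))"
    unfolding top bottom by (simp only: left_diff_distrib)
  then show ?thesis unfolding jump t_def[symmetric] by (simp add: scaleR_conv_of_real)
qed

text \<open>
  The residue theorem on the rectangle with vertices \<plusminus>R \<plusminus> i\<pi>. The horizontal sides combine to an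
  integral of the jump, and t = e^x returns it to the positive half-line.
\<close>
lemma strip_contour_integral:
  assumes z: "Re z > 0" and R: "R > 0" "\<bar>ln (norm z)\<bar> < R"
  defines "right \<equiv> linepath (Complex R (- pi)) (Complex R pi)"
    and "left \<equiv> linepath (Complex (- R) pi) (Complex (- R) (- pi))"
  shows "strip_integrand z contour_integrable_on right"
    and "strip_integrand z contour_integrable_on left"
    and "2 * pi * \<i> * (\<Sum>p\<in>strip_poles z. residue (strip_integrand z) p)
      = - 2 * \<i> * integral {exp (- R)..exp R} (\<lambda>t. complex_of_real (jump_density t) / (complex_of_real t + z))
        + contour_integral right (strip_integrand z) + contour_integral left (strip_integrand z)"
proof -
  define S where "S = {u. - (3 * pi / 2) < Im u \<and> Im u < 3 * pi / 2}"
  let ?f = "strip_integrand z"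
  let ?a = "Complex (- R) (- pi)" and ?b = "Complex R pi"
  let ?g = "rectpath ?a ?b"
  have holo: "?f holomorphic_on S - strip_poles z"
    unfolding S_def by (rule strip_integrand_holomorphic[OF z])
  then have cont: "continuous_on (S - strip_poles z) ?f" by (rule holomorphic_on_imp_continuous_on)
  have z0: "z \<noteq> 0" using z by auto
  have inside: "strip_poles z \<subseteq> box ?a ?b"
    using R Re_Ln_pos_lt[OF z0] z z0 by (auto simp: strip_poles_def in_box_complex_iff)
  have sub: "cbox ?a ?b \<subseteq> S"
  proof
    fix w assume "w \<in> cbox ?a ?b"
    then have "- pi \<le> Im w" "Im w \<le> pi" by (auto simp: in_cbox_complex_iff)
    then show "w \<in> S" unfolding S_def mem_Collect_eq using pi_gt_zero by linarith
  qed
  have img: "path_image ?g \<subseteq> S - strip_poles z"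
    using inside sub R by (subst path_image_rectpath_cbox_minus_box) auto
  have "contour_integral ?g ?f = 2 * pi * \<i> * (\<Sum>p\<in>strip_poles z. winding_number ?g p * residue ?f p)"
  proof (rule Residue_theorem[OF _ _ _ holo _ _ img])
    show "open S" unfolding S_def by (rule open_Im_strip)
    have "convex S"
      using convex_Int[OF convex_halfspace_Im_gt[of "- (3 * pi / 2)"] convex_halfspace_Im_lt[of "3 * pi / 2"]]
      by (simp add: S_def Collect_conj_eq)
    then show "connected S" by (rule convex_connected)
    show "finite (strip_poles z)" by (simp add: strip_poles_def)
    show "\<forall>w. w \<notin> S \<longrightarrow> winding_number ?g w = 0"
      using sub R by (auto intro!: winding_number_rectpath_outside)
  qed simp_all
  also have "(\<Sum>p\<in>strip_poles z. winding_number ?g p * residue ?f p) = (\<Sum>p\<in>strip_poles z. residue ?f p)"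
    using inside by (intro sum.cong) (auto simp: winding_number_rectpath)
  finally have residues: "contour_integral ?g ?f = 2 * pi * \<i> * (\<Sum>p\<in>strip_poles z. residue ?f p)" .
  let ?bottom = "linepath ?a (Complex R (- pi))" and ?top = "linepath ?b (Complex (- R) pi)"
  have path: "?g = ?bottom +++ right +++ ?top +++ left"
    by (simp add: rectpath_def right_def left_def Let_def)
  have seg: "closed_segment ?a (Complex R (- pi)) \<subseteq> S - strip_poles z" "closed_segment (Complex R (- pi)) ?b \<subseteq> S - strip_poles z"
    "closed_segment ?b (Complex (- R) pi) \<subseteq> S - strip_poles z" "closed_segment (Complex (- R) pi) ?a \<subseteq> S - strip_poles z"
    using img unfolding path right_def left_def by (auto simp: path_image_join)
  have int: "?f contour_integrable_on ?bottom" "?f contour_integrable_on right"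
    "?f contour_integrable_on ?top" "?f contour_integrable_on left"
    unfolding right_def left_def
    by (intro contour_integrable_continuous_linepath continuous_on_subset[OF cont] seg)+
  show "?f contour_integrable_on right" "?f contour_integrable_on left" by (rule int)+
  \<comment> \<open>The poles lie in the open rectangle, so its horizontal sides avoid them.\<close>
  have horiz: "continuous_on {- R..R} (\<lambda>x. ?f (Complex x c))" if "c = pi \<or> c = - pi" for c
  proof (rule continuous_on_compose2[OF cont])
    show "continuous_on {- R..R} (\<lambda>x. Complex x c)"
      by (simp add: Complex_eq continuous_intros)
    show "(\<lambda>x. Complex x c) ` {- R..R} \<subseteq> S - strip_poles z"
    proof
      fix u assume "u \<in> (\<lambda>x. Complex x c) ` {- R..R}"
      then have "Im u = c" by auto
      then have "u \<in> S" "u \<notin> box ?a ?b"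
        using that pi_gt_zero by (auto simp: S_def in_box_complex_iff less_le_trans[of _ 0])
      then show "u \<in> S - strip_poles z" using inside by blast
    qed
  qed
  have "contour_integral ?g ?f = contour_integral ?bottom ?f + contour_integral right ?f
      + contour_integral ?top ?f + contour_integral left ?f"
    unfolding path using int by (simp add: right_def left_def contour_integrable_joinI)
  also have "contour_integral ?bottom ?f = integral {- R..R} (\<lambda>x. ?f (Complex x (- pi)))"
    using R horiz by (intro contour_integral_linepath_same_Im) auto
  also have "contour_integral ?top ?f = - contour_integral (linepath (Complex (- R) pi) ?b) ?f"
    by (intro contour_integral_reverse_linepath continuous_on_subset[OF cont] seg)
  also have "contour_integral (linepath (Complex (- R) pi) ?b) ?f = integral {- R..R} (\<lambda>x. ?f (Complex x pi))"
    using R horiz by (intro contour_integral_linepath_same_Im) auto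
  also have "integral {- R..R} (\<lambda>x. ?f (Complex x (- pi))) + contour_integral right ?f
      + - integral {- R..R} (\<lambda>x. ?f (Complex x pi)) + contour_integral left ?f
      = integral {- R..R} (\<lambda>x. ?f (Complex x (- pi)) - ?f (Complex x pi))
      + contour_integral right ?f + contour_integral left ?f"
    using horiz by (subst integral_diff) (auto intro!: integrable_continuous_real)
  also have "integral {- R..R} (\<lambda>x. ?f (Complex x (- pi)) - ?f (Complex x pi))
      = - 2 * \<i> * integral {- R..R} (\<lambda>x. exp x *\<^sub>R (complex_of_real (jump_density (exp x)) / (complex_of_real (exp x) + z)))"
    unfolding strip_integrand_jump[OF z] by (rule integral_mult_right)
  also have "integral {- R..R} (\<lambda>x. exp x *\<^sub>R (complex_of_real (jump_density (exp x)) / (complex_of_real (exp x) + z)))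
      = integral {exp (- R)..exp R} (\<lambda>t. complex_of_real (jump_density t) / (complex_of_real t + z))"
  proof (rule integral_unique, rule has_integral_substitution[where c = "exp (- R)" and d = "exp R"])
    show "continuous_on {exp (- R)..exp R} (\<lambda>t. complex_of_real (jump_density t) / (complex_of_real t + z))"
    proof (intro continuous_intros continuous_on_subset[OF continuous_on_jump_density])
      have pos: "t > 0" if "t \<in> {exp (- R)..exp R}" for t :: real
        using that by (auto intro: less_le_trans[OF exp_gt_zero])
      then show "{exp (- R)..exp R} \<subseteq> {0<..}" by auto
      show "\<forall>t\<in>{exp (- R)..exp R}. complex_of_real t + z \<noteq> 0"
        using of_real_add_neq_0[OF z] pos by (auto simp: less_imp_le)
    qed
  qed (use R in \<open>auto intro!: derivative_eq_intros\<close>)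
  finally show "2 * pi * \<i> * (\<Sum>p\<in>strip_poles z. residue ?f p)
      = - 2 * \<i> * integral {exp (- R)..exp R} (\<lambda>t. complex_of_real (jump_density t) / (complex_of_real t + z))
        + contour_integral right ?f + contour_integral left ?f"
    unfolding residues .
qed

lemma tendsto_truncated_stieltjes:
  assumes z: "Re z > 0"
  shows "(\<lambda>n. integral {exp (- real n)..exp (real n)} (\<lambda>t. complex_of_real (jump_density t) / (complex_of_real t + z)))
    \<longlonglongrightarrow> (LBINT t:{0<..}. complex_of_real (jump_density t) / (complex_of_real t + z))"
proof -
  let ?h = "\<lambda>t. complex_of_real (jump_density t) / (complex_of_real t + z)"
  define A where "A = (\<lambda>n. {exp (- real n)..exp (real n)})"
  have "(\<Union>n. A n) = {0<..}"
  proof (intro equalityI subsetI)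
    fix t assume "t \<in> (\<Union>n. A n)"
    then show "t \<in> {0<..}" by (auto simp: A_def intro: less_le_trans[OF exp_gt_zero])
  next
    fix t :: real assume t: "t \<in> {0<..}"
    obtain n :: nat where "\<bar>ln t\<bar> \<le> real n" using real_arch_simple by blast
    then have "- real n \<le> ln t" "ln t \<le> real n" by linarith+
    then have "exp (- real n) \<le> exp (ln t)" "exp (ln t) \<le> exp (real n)"
      unfolding exp_le_cancel_iff .
    moreover have "exp (ln t) = t" using t by simp
    ultimately have "t \<in> A n" unfolding A_def by (simp only: atLeastAtMost_iff)
    then show "t \<in> (\<Union>n. A n)" by blast
  qed
  note A_Un = this
  have int: "set_integrable lborel (\<Union>n. A n) ?h"
    unfolding A_Un by (rule set_integrable_jump_density_stieltjes[OF z])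
  have "(\<lambda>n. LBINT t:A n. ?h t) \<longlonglongrightarrow> (LBINT t:(\<Union>n. A n). ?h t)"
    by (rule set_integral_cont_up[OF _ _ int]) (auto simp: A_def incseq_def)
  moreover have "(LBINT t:A n. ?h t) = integral (A n) ?h" for n
    by (rule set_borel_integral_eq_integral(2)[OF set_integrable_subset[OF int]]) (auto simp: A_def)
  ultimately show ?thesis unfolding A_Un by (simp add: A_def)
qed

text \<open>
  Cauchy's formula on the slit plane, obtained from the rectangle by letting R = n tend to
  infinity.
\<close>
theorem exp_B_stieltjes_representation:
  assumes z: "Re z > 0"
  shows "exp (B z) / (1 + z\<^sup>2)
    = complex_of_real (sqrt 2) * (complex_of_real (cos (pi / 8)) + z * complex_of_real (sin (pi / 8))) / (1 + z\<^sup>2)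
      - complex_of_real (1 / pi) * (LBINT t:{0<..}. complex_of_real (jump_density t) / (complex_of_real t + z))"
proof -
  define J where "J = (LBINT t:{0<..}. complex_of_real (jump_density t) / (complex_of_real t + z))"
  define I where "I = (\<lambda>n. integral {exp (- real n)..exp (real n)}
      (\<lambda>t. complex_of_real (jump_density t) / (complex_of_real t + z)))"
  define S where "S = (\<Sum>p\<in>strip_poles z. residue (strip_integrand z) p)"
  have z0: "z \<noteq> 0" using z by auto
  obtain M where M: "(M \<longlongrightarrow> 0) at_top" "((\<lambda>R. M (- R)) \<longlongrightarrow> 0) at_top"
    "\<And>u. exp (Re u) \<noteq> 1 \<Longrightarrow> exp (Re u) \<noteq> norm z \<Longrightarrow> \<bar>Im u\<bar> \<le> pi \<Longrightarrow>
      norm (strip_integrand z u) \<le> M (Re u)"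
    using norm_strip_integrand_le[OF z0] by blast
  have "(\<lambda>n. 2 * pi * \<i> * S + 2 * \<i> * I n) \<longlonglongrightarrow> 0"
  proof (rule Lim_null_comparison)
    have Mn: "(\<lambda>n. M (real n)) \<longlonglongrightarrow> 0" "(\<lambda>n. M (- real n)) \<longlonglongrightarrow> 0"
      using M(1,2) by (auto intro: filterlim_compose[OF _ filterlim_real_sequentially])
    have "(\<lambda>n. (M (real n) + M (- real n)) * (2 * pi)) \<longlonglongrightarrow> (0 + 0) * (2 * pi)"
      by (intro tendsto_intros Mn)
    then show "(\<lambda>n. (M (real n) + M (- real n)) * (2 * pi)) \<longlonglongrightarrow> 0" by simp
    show "\<forall>\<^sub>F n in sequentially. norm (2 * pi * \<i> * S + 2 * \<i> * I n) \<le> (M (real n) + M (- real n)) * (2 * pi)"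
      using filterlim_at_top_dense[THEN iffD1, OF filterlim_real_sequentially, rule_format, of "\<bar>ln (norm z)\<bar>"]
        eventually_gt_at_top[of "0::nat"]
    proof eventually_elim
      case (elim n)
      let ?r = "linepath (Complex (real n) (- pi)) (Complex (real n) pi)"
      let ?l = "linepath (Complex (- real n) pi) (Complex (- real n) (- pi))"
      have n: "real n > 0" using elim by simp
      note strip = strip_contour_integral[OF z n elim(1)]
      have nz: "exp (real n) \<noteq> 1" "exp (- real n) \<noteq> 1" using n by simp_all
      have "exp (real n) \<noteq> norm z" "exp (- real n) \<noteq> norm z"
        using elim(1) by (metis abs_of_nat less_irrefl ln_exp abs_minus_cancel)+
      have bounds: "norm (strip_integrand z u) \<le> M (Re u)" if "\<bar>Re u\<bar> = real n" "\<bar>Im u\<bar> \<le> pi" for u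
      proof -
        have "Re u = real n \<or> Re u = - real n" using that(1) by linarith
        then show ?thesis
          using nz \<open>exp (real n) \<noteq> norm z\<close> \<open>exp (- real n) \<noteq> norm z\<close> that(2) by (auto intro: M(3))
      qed
      have nonneg: "0 \<le> M (real n)" "0 \<le> M (- real n)"
        using order_trans[OF norm_ge_zero bounds[of "complex_of_real (real n)"]]
          order_trans[OF norm_ge_zero bounds[of "complex_of_real (- real n)"]] by simp_all
      have seg: "\<bar>Re u\<bar> = real n \<and> \<bar>Im u\<bar> \<le> pi \<and> Re u = Re v"
        if "u \<in> closed_segment v (Complex c d)" "v = Complex c (- d)" "\<bar>c\<bar> = real n" "\<bar>d\<bar> = pi" for u v c d
        using that by (auto simp: closed_segment_same_Re closed_segment_eq_real_ivl split: if_splits)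
      have "norm (contour_integral ?r (strip_integrand z)) \<le> M (real n) * norm (Complex (real n) pi - Complex (real n) (- pi))"
      proof (rule contour_integral_bound_linepath[OF strip(1) nonneg(1)])
        fix u assume "u \<in> closed_segment (Complex (real n) (- pi)) (Complex (real n) pi)"
        from seg[OF this] show "norm (strip_integrand z u) \<le> M (real n)"
          using bounds[of u] by simp
      qed
      moreover have "norm (contour_integral ?l (strip_integrand z)) \<le> M (- real n) * norm (Complex (- real n) (- pi) - Complex (- real n) pi)"
      proof (rule contour_integral_bound_linepath[OF strip(2) nonneg(2)])
        fix u assume "u \<in> closed_segment (Complex (- real n) pi) (Complex (- real n) (- pi))"
        from seg[OF this] show "norm (strip_integrand z u) \<le> M (- real n)"
          using bounds[of u] by simp
      qed
      moreover have "norm (Complex (real n) pi - Complex (real n) (- pi)) = 2 * pi"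
        "norm (Complex (- real n) (- pi) - Complex (- real n) pi) = 2 * pi"
        by (simp_all add: cmod_def real_sqrt_mult)
      moreover have "2 * pi * \<i> * S + 2 * \<i> * I n = contour_integral ?r (strip_integrand z) + contour_integral ?l (strip_integrand z)"
        using strip(3) by (simp add: S_def I_def)
      ultimately show ?case
        using norm_triangle_ineq[of "contour_integral ?r (strip_integrand z)" "contour_integral ?l (strip_integrand z)"]
        by (simp add: distrib_right)
    qed
  qed
  moreover have "(\<lambda>n. 2 * pi * \<i> * S + 2 * \<i> * I n) \<longlonglongrightarrow> 2 * pi * \<i> * S + 2 * \<i> * J"
    unfolding I_def J_def by (intro tendsto_intros tendsto_truncated_stieltjes[OF z])
  ultimately have "2 * pi * \<i> * S + 2 * \<i> * J = 0" by (rule LIMSEQ_unique[rotated])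
  then have "2 * \<i> * (pi * S + J) = 0" by (simp add: algebra_simps)
  then have "complex_of_real pi * S = - J" by (simp add: eq_neg_iff_add_eq_0)
  then have "S = - complex_of_real (1 / pi) * J" by (simp add: field_simps)
  then show ?thesis
    unfolding S_def sum_residues_strip_integrand[OF z] J_def by (simp add: algebra_simps)
qed

section \<open>Laplace transforms\<close>

lemma norm_exp_minus_mult_of_real: "norm (exp (- w * complex_of_real x)) = exp (- Re w * x)"
  by simp

lemma
  assumes w: "Re w > 0"
  shows set_integrable_exp_minus: "set_integrable lborel {0<..} (\<lambda>x. exp (- w * complex_of_real x))"
    and integral_exp_minus: "(LBINT x:{0<..}. exp (- w * complex_of_real x)) = 1 / w"
proof -
  define a where "a = Re w"
  have a: "a > 0" using w by (simp add: a_def)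
  have pos_half_line: "einterval 0 \<infinity> = {0::real<..}" by (auto simp: einterval_def)
  have "set_integrable lborel (einterval 0 \<infinity>) (\<lambda>x. exp (- a * x))"
  proof (rule interval_integral_FTC_nonneg[where F = "\<lambda>x. - exp (- a * x) / a" and A = "- inverse a" and B = 0])
    show "(((\<lambda>x. - exp (- a * x) / a) \<circ> real_of_ereal) \<longlongrightarrow> - inverse a) (at_right 0)"
      unfolding zero_ereal_def ereal_tendsto_simps using a by real_asymp
    show "(((\<lambda>x. - exp (- a * x) / a) \<circ> real_of_ereal) \<longlongrightarrow> 0) (at_left \<infinity>)"
      unfolding ereal_tendsto_simps using a by real_asymp
  qed (use a in \<open>auto intro!: derivative_eq_intros continuous_intros\<close>)
  then have "set_integrable lborel {0<..} (\<lambda>x. exp (- a * x))" unfolding pos_half_line .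
  then show int: "set_integrable lborel {0<..} (\<lambda>x. exp (- w * complex_of_real x))"
    by (rule set_integrable_half_line_mono) (auto intro!: continuous_intros simp: a_def)
  define F where "F = (\<lambda>x. - exp (- w * complex_of_real x) / w)"
  have w0: "w \<noteq> 0" using w by auto
  have "(LBINT x=0..\<infinity>. exp (- w * complex_of_real x)) = 0 - (- 1 / w)"
  proof (rule interval_integral_FTC_integrable[where F = F])
    show "(F has_vector_derivative exp (- w * complex_of_real x)) (at x)" for x
    proof -
      have "((\<lambda>u. - exp (- w * u) / w) has_field_derivative exp (- w * complex_of_real x)) (at (complex_of_real x))"
        using w0 by (auto intro!: derivative_eq_intros)
      then show ?thesis unfolding F_def by (rule has_vector_derivative_real_field)
    qed
    show "set_integrable lborel (einterval 0 \<infinity>) (\<lambda>x. exp (- w * complex_of_real x))"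
      using int unfolding pos_half_line .
    have "isCont F 0" unfolding F_def using w0 by (intro continuous_intros) auto
    then have "(F \<longlongrightarrow> F 0) (at_right 0)" by (simp add: isCont_def filterlim_at_split)
    then show "((F \<circ> real_of_ereal) \<longlongrightarrow> - 1 / w) (at_right 0)"
      unfolding zero_ereal_def ereal_tendsto_simps by (simp add: F_def)
    have "((\<lambda>x. norm (exp (- w * complex_of_real x))) \<longlongrightarrow> 0) at_top"
      unfolding norm_exp_minus_mult_of_real a_def[symmetric] using a by real_asymp
    then have "((\<lambda>x. exp (- w * complex_of_real x)) \<longlongrightarrow> 0) at_top"
      by (rule tendsto_norm_zero_cancel)
    then have "(F \<longlongrightarrow> - 0 / w) at_top"
      unfolding F_def using w0 by (intro tendsto_divide tendsto_minus tendsto_const)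
    then show "((F \<circ> real_of_ereal) \<longlongrightarrow> 0) (at_left \<infinity>)"
      unfolding ereal_tendsto_simps by simp
  qed (auto intro!: continuous_intros)
  then show "(LBINT x:{0<..}. exp (- w * complex_of_real x)) = 1 / w"
    by (simp add: interval_lebesgue_integral_0_infty)
qed

text \<open>
  Euler's formula reduces the transform to those of two exponentials.
\<close>
lemma laplace_sine:
  assumes z: "Re z > 0"
  shows "set_integrable lborel {0<..} (laplace_integrand (\<lambda>x. sin (lam * x + \<theta>)) z)"
    and "laplace (\<lambda>x. sin (lam * x + \<theta>)) z
      = (complex_of_real lam * complex_of_real (cos \<theta>) + z * complex_of_real (sin \<theta>))
        / ((complex_of_real lam)\<^sup>2 + z\<^sup>2)"
proof -
  let ?L = "complex_of_real lam"
  define e1 where "e1 = (\<lambda>x. exp (- (z - \<i> * ?L) * complex_of_real x))"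
  define e2 where "e2 = (\<lambda>x. exp (- (z + \<i> * ?L) * complex_of_real x))"
  have re: "Re (z - \<i> * ?L) > 0" "Re (z + \<i> * ?L) > 0" using z by simp_all
  note int = set_integrable_exp_minus[OF re(1), folded e1_def] set_integrable_exp_minus[OF re(2), folded e2_def]
  have eq: "laplace_integrand (\<lambda>x. sin (lam * x + \<theta>)) z =
      (\<lambda>x. cis \<theta> / (2 * \<i>) * e1 x - cis (- \<theta>) / (2 * \<i>) * e2 x)"
  proof
    fix x
    have "complex_of_real (sin y) = (cis y - cis (- y)) / (2 * \<i>)" for y
      by (simp add: complex_eq_iff)
    note this[of "lam * x + \<theta>"]
    moreover have "cis (lam * x + \<theta>) * exp (- z * complex_of_real x) = cis \<theta> * e1 x"
      "cis (- (lam * x + \<theta>)) * exp (- z * complex_of_real x) = cis (- \<theta>) * e2 x"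
      by (simp_all add: e1_def e2_def cis_conv_exp algebra_simps flip: exp_add)
    ultimately show "laplace_integrand (\<lambda>x. sin (lam * x + \<theta>)) z x
        = cis \<theta> / (2 * \<i>) * e1 x - cis (- \<theta>) / (2 * \<i>) * e2 x"
      by (simp only: laplace_integrand_def left_diff_distrib diff_divide_distrib times_divide_eq_left)
  qed
  show "set_integrable lborel {0<..} (laplace_integrand (\<lambda>x. sin (lam * x + \<theta>)) z)"
    unfolding eq by (intro set_integral_diff set_integrable_mult_right int)
  have "laplace (\<lambda>x. sin (lam * x + \<theta>)) z = (LBINT x:{0<..}. cis \<theta> / (2 * \<i>) * e1 x)
      - (LBINT x:{0<..}. cis (- \<theta>) / (2 * \<i>) * e2 x)"
    unfolding laplace_def eq by (intro set_integral_diff set_integrable_mult_right int)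
  also have "\<dots> = cis \<theta> / (2 * \<i>) * (1 / (z - \<i> * ?L)) - cis (- \<theta>) / (2 * \<i>) * (1 / (z + \<i> * ?L))"
    unfolding set_integral_mult_right e1_def e2_def integral_exp_minus[OF re(1)] integral_exp_minus[OF re(2)] ..
  also have "\<dots> = (cis \<theta> * (z + \<i> * ?L) - cis (- \<theta>) * (z - \<i> * ?L)) / (2 * \<i> * ((z - \<i> * ?L) * (z + \<i> * ?L)))"
  proof -
    have "z - \<i> * ?L \<noteq> 0" "z + \<i> * ?L \<noteq> 0" using re by (metis less_irrefl zero_complex.sel(1))+
    moreover have "a / (2 * \<i>) * (1 / A) - b / (2 * \<i>) * (1 / C) = (a * C - b * A) / (2 * \<i> * (A * C))"
      if "A \<noteq> 0" "C \<noteq> 0" for a b A C :: complex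
      using that by (simp add: field_simps)
    ultimately show ?thesis by blast
  qed
  also have "cis \<theta> * (z + \<i> * ?L) - cis (- \<theta>) * (z - \<i> * ?L)
      = 2 * \<i> * (?L * complex_of_real (cos \<theta>) + z * complex_of_real (sin \<theta>))"
  proof -
    have cis: "cis \<theta> = complex_of_real (cos \<theta>) + \<i> * complex_of_real (sin \<theta>)"
      "cis (- \<theta>) = complex_of_real (cos \<theta>) - \<i> * complex_of_real (sin \<theta>)"
      by (simp_all add: complex_eq_iff)
    show ?thesis unfolding cis by (simp add: algebra_simps)
  qed
  also have "(z - \<i> * ?L) * (z + \<i> * ?L) = ?L\<^sup>2 + z\<^sup>2"
    by (simp add: power2_eq_square algebra_simps)
  finally show "laplace (\<lambda>x. sin (lam * x + \<theta>)) z
      = (?L * complex_of_real (cos \<theta>) + z * complex_of_real (sin \<theta>)) / (?L\<^sup>2 + z\<^sup>2)"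
    by simp
qed

lemma r_eq: "r x = sqrt 2 / (2 * pi) * (LBINT t:{0<..}. jump_density t * exp (- (t * x)))"
  by (simp add: r_def jump_density_def)

text \<open>
  Fubini's theorem for jump_density t times e^(-(\<lambda>t + z) x): integrating out x first leaves the
  absolute integral of jump_density t / (\<lambda>t + Re z), which is finite.
\<close>
lemma laplace_r:
  assumes lam: "lam > 0" and z: "Re z > 0"
  shows "set_integrable lborel {0<..} (laplace_integrand (\<lambda>x. r (lam * x)) z)"
    and "laplace (\<lambda>x. r (lam * x)) z = complex_of_real (sqrt 2 / (2 * pi)) *
      (LBINT t:{0<..}. complex_of_real (jump_density t) / (complex_of_real (lam * t) + z))"
proof -
  define c where "c = sqrt 2 / (2 * pi)"
  define k where "k = (\<lambda>t. indicator {0<..} t * jump_density t)"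
  define ind :: "real \<Rightarrow> real" where "ind = indicator {0<..}"
  define w where "w = (\<lambda>t. complex_of_real (lam * t) + z)"
  \<comment> \<open>The indicators turn both half-line integrals into integrals over the whole line.\<close>
  define F where "F = (\<lambda>t x. complex_of_real (k t) * (ind x *\<^sub>R exp (- w t * complex_of_real x)))"
  have k_int: "integrable lborel k"
    using set_integrable_jump_density by (simp add: set_integrable_def k_def)
  then have [measurable]: "k \<in> borel_measurable borel" by simp
  have [measurable]: "ind \<in> borel_measurable borel" by (simp add: ind_def)
  have [measurable]: "w \<in> borel_measurable borel"
    unfolding w_def by (intro borel_measurable_continuous_onI continuous_intros)
  have k_nonneg: "k t \<ge> 0" for t
    using jump_density_nonneg[of t] by (cases "t > 0") (simp_all add: k_def)
  have k_zero: "k t = 0" if "\<not> t > 0" for t using that by (simp add: k_def)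
  have w_re: "Re (w t) \<ge> Re z" if "t > 0" for t using that lam by (simp add: w_def)
  have exp_int: "integrable lborel (\<lambda>x. ind x *\<^sub>R exp (- w t * complex_of_real x))" if "t > 0" for t
    using set_integrable_exp_minus[of "w t"] w_re[OF that] z by (simp add: set_integrable_def ind_def)
  have F_int2: "integrable lborel (F t)" for t
  proof (cases "t > 0")
    case True
    then show ?thesis unfolding F_def by (intro integrable_mult_right exp_int)
  qed (simp add: F_def k_zero)
  have F_inner: "(LINT x|lborel. F t x) = complex_of_real (k t) / w t" for t
  proof (cases "t > 0")
    case True
    then have "Re (w t) > 0" using w_re[of t] z by linarith
    from integral_exp_minus[OF this] show ?thesis
      unfolding F_def integral_mult_right_zero by (simp add: set_lebesgue_integral_def ind_def)
  qed (simp add: F_def k_zero)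
  have F_norm: "(LINT x|lborel. norm (F t x)) = k t / Re (w t)" for t
  proof (cases "t > 0")
    case True
    then have "Re (complex_of_real (Re (w t))) > 0" using w_re[of t] z by simp
    from integral_exp_minus[OF this]
    have "complex_of_real (LBINT x:{0<..}. exp (- Re (w t) * x)) = complex_of_real (1 / Re (w t))"
      unfolding set_integral_complex_of_real[symmetric] by (simp add: exp_of_real flip: of_real_mult of_real_minus)
    then have "(LBINT x:{0<..}. exp (- Re (w t) * x)) = 1 / Re (w t)" unfolding of_real_eq_iff .
    moreover have "norm (F t x) = k t * (ind x *\<^sub>R exp (- Re (w t) * x))" for x
      using k_nonneg[of t] by (simp add: F_def norm_mult ind_def)
    ultimately show ?thesis by (simp add: set_lebesgue_integral_def ind_def)
  qed (simp add: F_def k_zero)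
  have F_pair: "integrable (lborel \<Otimes>\<^sub>M lborel) (\<lambda>(t, x). F t x)"
  proof (rule lborel_pair.Fubini_integrable)
    show "(\<lambda>(t, x). F t x) \<in> borel_measurable (lborel \<Otimes>\<^sub>M lborel)"
      unfolding F_def by measurable
    show "AE t in lborel. integrable lborel (\<lambda>x. case (t, x) of (t, x) \<Rightarrow> F t x)"
      using F_int2 by simp
    have "integrable lborel (\<lambda>t. k t / Re (w t))"
    proof (rule Bochner_Integration.integrable_bound)
      show "integrable lborel (\<lambda>t. k t / Re z)" using k_int by simp
      show "(\<lambda>t. k t / Re (w t)) \<in> borel_measurable lborel" by measurable
      have "norm (k t / Re (w t)) \<le> norm (k t / Re z)" for t
      proof (cases "t > 0")
        case True
        then have "k t / Re (w t) \<le> k t / Re z"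
          using w_re[OF True] z k_nonneg[of t] by (intro divide_left_mono mult_pos_pos) auto
        then show ?thesis using k_nonneg[of t] w_re[OF True] z by simp
      qed (simp add: k_zero)
      then show "AE t in lborel. norm (k t / Re (w t)) \<le> norm (k t / Re z)" by simp
    qed
    then show "integrable lborel (\<lambda>t. LINT x|lborel. norm (case (t, x) of (t, x) \<Rightarrow> F t x))"
      by (simp add: F_norm)
  qed
  have F_outer: "ind x *\<^sub>R laplace_integrand (\<lambda>x. r (lam * x)) z x = complex_of_real c * (LINT t|lborel. F t x)" for x
  proof -
    have "exp (- w t * complex_of_real x)
        = complex_of_real (exp (- (t * (lam * x)))) * exp (- z * complex_of_real x)" for t
      unfolding exp_of_real[symmetric] exp_add[symmetric] by (simp add: w_def algebra_simps)
    then have "(LINT t|lborel. F t x) = (LINT t|lborel. complex_of_real (k t * exp (- (t * (lam * x))))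
        * (ind x *\<^sub>R exp (- z * complex_of_real x)))"
      by (intro Bochner_Integration.integral_cong) (simp_all add: F_def mult_ac)
    also have "\<dots> = complex_of_real (LINT t|lborel. k t * exp (- (t * (lam * x))))
        * (ind x *\<^sub>R exp (- z * complex_of_real x))"
      by (simp only: integral_mult_left_zero integral_complex_of_real)
    finally show ?thesis
      by (simp add: laplace_integrand_def r_eq c_def k_def set_lebesgue_integral_def mult_ac)
  qed
  have "integrable lborel (\<lambda>x. complex_of_real c * (LINT t|lborel. F t x))"
    using lborel_pair.integrable_snd[OF F_pair] by simp
  then show "set_integrable lborel {0<..} (laplace_integrand (\<lambda>x. r (lam * x)) z)"
    unfolding set_integrable_def F_outer[symmetric] by (simp add: ind_def)
  have "laplace (\<lambda>x. r (lam * x)) z = (LINT x|lborel. complex_of_real c * (LINT t|lborel. F t x))"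
    unfolding laplace_def set_lebesgue_integral_def F_outer[symmetric] by (simp add: ind_def)
  also have "\<dots> = complex_of_real c * (LINT t|lborel. LINT x|lborel. F t x)"
    using lborel_pair.Fubini_integral[OF F_pair] by simp
  also have "(LINT t|lborel. LINT x|lborel. F t x) =
      (LBINT t:{0<..}. complex_of_real (jump_density t) / (complex_of_real (lam * t) + z))"
    unfolding F_inner set_lebesgue_integral_def
    by (intro Bochner_Integration.integral_cong) (auto simp: k_def w_def indicator_def)
  finally show "laplace (\<lambda>x. r (lam * x)) z = complex_of_real (sqrt 2 / (2 * pi)) *
      (LBINT t:{0<..}. complex_of_real (jump_density t) / (complex_of_real (lam * t) + z))"
    unfolding c_def .
qed

theorem corollary1:
  fixes lam :: real and z :: complex
  assumes "lam > 0" and "Re z > 0"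
  shows "set_integrable lborel {0<..} (laplace_integrand (psi lam) z) \<and>
         laplace (psi lam) z =
           complex_of_real (sqrt 2 / 2) *
             (complex_of_real lam * exp (B (z / complex_of_real lam)) /
               ((complex_of_real lam)\<^sup>2 + z\<^sup>2))"
proof -
  define L where "L = complex_of_real lam"
  define w where "w = z / L"
  have L0: "L \<noteq> 0" using assms(1) by (simp add: L_def)
  have w: "Re w > 0" using assms by (simp add: w_def L_def)
  have zw: "z = L * w" using L0 by (simp add: w_def)
  note sine = laplace_sine[OF assms(2), of lam "pi / 8"]
  note rem = laplace_r[OF assms]
  have eq: "laplace_integrand (psi lam) z = (\<lambda>x. laplace_integrand (\<lambda>x. sin (lam * x + pi / 8)) z x
      - laplace_integrand (\<lambda>x. r (lam * x)) z x)"
    by (simp add: fun_eq_iff laplace_integrand_def psi_def left_diff_distrib)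
  have int: "set_integrable lborel {0<..} (laplace_integrand (psi lam) z)"
    unfolding eq by (intro set_integral_diff sine(1) rem(1))
  define J where "J = (LBINT t:{0<..}. complex_of_real (jump_density t) / (complex_of_real t + w))"
  let ?c = "complex_of_real (cos (pi / 8))" and ?s = "complex_of_real (sin (pi / 8))"
  define q where "q = complex_of_real (sqrt 2)"
  have qq: "q * q = 2" by (simp add: q_def flip: of_real_mult)
  have "laplace (psi lam) z = laplace (\<lambda>x. sin (lam * x + pi / 8)) z - laplace (\<lambda>x. r (lam * x)) z"
    unfolding laplace_def eq by (intro set_integral_diff sine(1) rem(1))
  also have "laplace (\<lambda>x. sin (lam * x + pi / 8)) z = 1 / L * ((?c + w * ?s) / (1 + w\<^sup>2))"
  proof -
    have "L * ?c + z * ?s = L * (?c + w * ?s)" "L\<^sup>2 + z\<^sup>2 = L * (L * (1 + w\<^sup>2))"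
      unfolding zw by (simp_all add: power2_eq_square algebra_simps)
    then show ?thesis unfolding sine(2) L_def[symmetric] using L0 by simp
  qed
  also have "laplace (\<lambda>x. r (lam * x)) z = 1 / L * (q / (2 * complex_of_real pi) * J)"
  proof -
    have "(LBINT t:{0<..}. complex_of_real (jump_density t) / (complex_of_real (lam * t) + z))
        = (LBINT t:{0<..}. 1 / L * (complex_of_real (jump_density t) / (complex_of_real t + w)))"
    proof (intro set_lebesgue_integral_cong allI impI)
      fix t :: real
      have "complex_of_real (lam * t) + z = L * (complex_of_real t + w)"
        unfolding zw by (simp add: L_def algebra_simps)
      then show "complex_of_real (jump_density t) / (complex_of_real (lam * t) + z)
          = 1 / L * (complex_of_real (jump_density t) / (complex_of_real t + w))" by simp
    qed simp
    then show ?thesis unfolding rem(2) set_integral_mult_right J_def by (simp add: q_def)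
  qed
  also have "1 / L * ((?c + w * ?s) / (1 + w\<^sup>2)) - 1 / L * (q / (2 * complex_of_real pi) * J)
      = q / 2 / L * (q * (?c + w * ?s) / (1 + w\<^sup>2) - complex_of_real (1 / pi) * J)"
  proof -
    have "q / 2 / L * (q * X - complex_of_real (1 / pi) * J) = 1 / L * X - 1 / L * (q / (2 * complex_of_real pi) * J)" for X
    proof -
      have "q / 2 / L * (q * X) = (q * q) / 2 / L * X" by simp
      then show ?thesis by (simp add: right_diff_distrib qq)
    qed
    then show ?thesis by (metis times_divide_eq_right)
  qed
  also have "q * (?c + w * ?s) / (1 + w\<^sup>2) - complex_of_real (1 / pi) * J = exp (B w) / (1 + w\<^sup>2)"
    unfolding q_def J_def exp_B_stieltjes_representation[OF w] ..
  also have "q / 2 / L * (exp (B w) / (1 + w\<^sup>2)) = complex_of_real (sqrt 2 / 2) * (L * exp (B w) / (L\<^sup>2 + z\<^sup>2))"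
  proof -
    have "L\<^sup>2 + z\<^sup>2 = L * (L * (1 + w\<^sup>2))" unfolding zw by (simp add: power2_eq_square algebra_simps)
    then show ?thesis using L0 by (simp add: q_def)
  qed
  finally show ?thesis using int unfolding w_def L_def by blast
qed

end
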